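(* Let $\mu=(\mu(t);0\le t\le 1)$ be a permuton valued path from $\mu(0)=\mathbf{id}$ to $\mu(1)=\mathbf{rev}$. Then the energy of $\mu$ in the Wasserstein metric satisfies $\mathcal{E}[\mu]\ge \mathcal{E}[\mathbf{A}]=\pi^2/6$, where $\mathbf{A}$ is the Archimedean path. If there is equality then $\mu(t)=\mathbf{A}(t)$ for every $t\in[0,1]$.
   Context: A permuton is a Borel probability measure on $[-1,1]^2$ both of whose marginals are uniform on $[-1,1]$; $\mathcal{P}$ denotes the set of permutons. The Wasserstein metric on $\mathcal{P}$ is the 2-Wasserstein distance for the Euclidean metric on $[-1,1]^2$: $W(\mu,\nu)^2=\inf \mathbb{E}[\|V-V'\|^2]$ over couplings $(V,V')$ with $V\sim\mu$, $V'\sim\nu$. A permuton valued path is a continuous map $[0,1]\to(\mathcal{P},W)$, and its energy is $$\mathcal{E}[\mu]=\sup_{\Pi}\sum_{i=1}^k\frac{W(\mu(t_i),\mu(t_{i-1}))^2}{t_i-t_{i-1}},$$ the supremum being over finite partitions $\Pi=\{0=t_0<t_1<\cdots<t_k=1\}$ of $[0,1]$. For $U$ uniform on $[-1,1]$, $\mathbf{id}$ is the law of $(U,U)$ and $\mathbf{rev}$ is the law of $(U,-U)$. The Archimedean measure is the unique probability measure on the plane all of whose projections onto lines through the origin have the uniform distribution on $[-1,1]$; it has density $\left(2\pi\sqrt{1-x^2-y^2}\right)^{-1}dx\,dy$ on the unit disk. With $(\mathbf{A}_x,\mathbf{A}_y)$ distributed according to it and $\mathcal{A}(t)=\cos(\pi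 t)\mathbf{A}_x+\sin(\pi t)\mathbf{A}_y$, the Archimedean path is the permuton valued path $\mathbf{A}$ for which $\mathbf{A}(t)$ is the law of $(\mathcal{A}(0),\mathcal{A}(t))$, $0\le t\le1$. *)

theory Defs
  imports "HOL-Probability.Probability"
begin

abbreviation unif :: "real measure" where
  "unif \<equiv> uniform_measure lborel {-1..1}"

text \<open>Permutons are Borel measures on the whole plane that are concentrated on the square.\<close>

definition permutons :: "(real \<times> real) measure set" where
  "permutons = {\<mu>. prob_space \<mu> \<and> sets \<mu> = sets borel \<and>
     emeasure \<mu> ({-1..1} \<times> {-1..1}) = 1 \<and>
     distr \<mu> borel fst = unif \<and> distr \<mu> borel snd = unif}"

definition couplings ::
  "(real \<times> real) measure \<Rightarrow> (real \<times> real) measure \<Rightarrow> ((real \<times> real) \<times> (real \<times> real)) measure set" where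
  "couplings \<mu> \<nu> = {\<gamma>. prob_space \<gamma> \<and> sets \<gamma> = sets borel \<and>
     distr \<gamma> borel fst = \<mu> \<and> distr \<gamma> borel snd = \<nu>}"

text \<open>The norm of the product type is the Euclidean one. On permutons the infimum is
  finite (at most 8), so the conversion to the reals loses nothing there.\<close>

definition wasserstein :: "(real \<times> real) measure \<Rightarrow> (real \<times> real) measure \<Rightarrow> real" where
  "wasserstein \<mu> \<nu> = sqrt (enn2real
     (INF \<gamma> \<in> couplings \<mu> \<nu>. \<integral>\<^sup>+ (v, v'). ennreal ((norm (v - v'))\<^sup>2) \<partial>\<gamma>))"

text \<open>Paths are functions on all of the reals; only their values on the unit interval matter.\<close>

definition permuton_path :: "(real \<Rightarrow> (real \<times> real) measure) \<Rightarrow> bool" where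
  "permuton_path \<mu> \<longleftrightarrow> (\<forall>t\<in>{0..1}. \<mu> t \<in> permutons) \<and>
     (\<forall>t\<in>{0..1}. \<forall>\<epsilon>>0. \<exists>\<delta>>0. \<forall>s\<in>{0..1}. \<bar>s - t\<bar> < \<delta> \<longrightarrow> wasserstein (\<mu> s) (\<mu> t) < \<epsilon>)"

definition partitions :: "(nat \<times> (nat \<Rightarrow> real)) set" where
  "partitions = {(k, t). t 0 = 0 \<and> t k = 1 \<and> strict_mono_on {0..k} t}"

definition energy :: "(real \<Rightarrow> (real \<times> real) measure) \<Rightarrow> ennreal" where
  "energy \<mu> = (SUP (k, t) \<in> partitions.
     ennreal (\<Sum>i=1..k. (wasserstein (\<mu> (t i)) (\<mu> (t (i - 1))))\<^sup>2 / (t i - t (i - 1))))"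

definition id_permuton :: "(real \<times> real) measure" where
  "id_permuton = distr unif borel (\<lambda>u. (u, u))"

definition rev_permuton :: "(real \<times> real) measure" where
  "rev_permuton = distr unif borel (\<lambda>u. (u, - u))"

text \<open>The projection onto the line spanned by a unit vector \<open>u\<close> is given by its
  coordinate \<open>p \<bullet> u\<close>. The measure described here exists, is unique, and has density
  \<open>1 / (2 * pi * sqrt (1 - x\<^sup>2 - y\<^sup>2))\<close> on the unit disk.\<close>

definition archimedean_measure :: "(real \<times> real) measure" where
  "archimedean_measure = (THE M. prob_space M \<and> sets M = sets borel \<and>
     (\<forall>u. norm u = 1 \<longrightarrow> distr M borel (\<lambda>p. p \<bullet> u) = unif))"

definition archimedean_process :: "real \<Rightarrow> real \<times> real \<Rightarrow> real" where
  "archimedean_process t = (\<lambda>(x, y). cos (pi * t) * x + sin (pi * t) * y)"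

definition archimedean_path :: "real \<Rightarrow> (real \<times> real) measure" where
  "archimedean_path t = distr archimedean_measure borel
     (\<lambda>p. (archimedean_process 0 p, archimedean_process t p))"

end

theory Submission
  imports Defs "HOL-Real_Asymp.Real_Asymp"
begin

text \<open>
  In the coordinates \<open>a = (x + y) / 2\<close>, \<open>b = (y - x) / 2\<close> every permuton has \<open>E a\<^sup>2 + E b\<^sup>2 = 1/3\<close>,
  so \<open>(\<parallel>a\<parallel>, \<parallel>b\<parallel>)\<close> (with \<open>L\<^sup>2\<close> norms) is a point of a quarter circle, described by an angle that is
  \<open>0\<close> for \<open>id\<close> and \<open>\<pi>/2\<close> for \<open>rev\<close>. By Cauchy-Schwarz the map to this quarter circle, suitably scaled, does not increase
  distances, so the energy is at least that of the quarter circle traversed at constant speed, which is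
  \<open>\<pi>\<^sup>2/6\<close>. Seen in a frame rotating at half speed, the points of the Archimedean path trace
  \<open>t \<mapsto> (cos (\<pi>t/2) A\<^sub>x, sin (\<pi>t/2) A\<^sub>y)\<close> in the coordinates \<open>(a, b)\<close>; this coupling shows that the bound is attained.

  If equality holds, then the angle at time \<open>t\<close> is \<open>\<pi>t/2\<close>, and a nearly optimal coupling of the path at times
  \<open>s\<close> and \<open>t\<close> nearly attains equality in Cauchy-Schwarz. Hence the law of
  \<open>(a / cos (\<pi>t/2), b / sin (\<pi>t/2))\<close> changes only by \<open>O((t - s)\<^sup>2)\<close>, so it does not depend on \<open>t\<close>. Since the
  marginals are uniform for every \<open>t\<close>, all projections of this law are uniform, and it is the
  Archimedean measure.
\<close>

section \<open>The uniform distribution and its moments\<close>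

lemma sets_unif [simp, measurable_cong]: "sets unif = sets borel"
  by (simp add: uniform_measure_def)

lemma space_unif [simp]: "space unif = UNIV"
  by (simp add: uniform_measure_def)

lemma real_distribution_unif: "real_distribution unif"
proof -
  interpret prob_space unif by (rule prob_space_uniform_measure) auto
  show ?thesis by unfold_locales auto
qed

lemma prob_space_unif: "prob_space unif"
  using real_distribution_unif by (simp add: real_distribution_def)

lemma AE_unif: "AE x in unif. x \<in> {-1..1}"
  by (rule AE_uniform_measureI) auto

lemma integral_unif:
  fixes f :: "real \<Rightarrow> real"
  assumes [measurable]: "f \<in> borel_measurable borel"
  shows "integral\<^sup>L unif f = (\<integral>x. f x * indicator {-1..1} x \<partial>lborel) / 2"
proof -
  have "unif = density lborel (\<lambda>x. ennreal (indicator {-1..1} x / 2))"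
    unfolding uniform_measure_def
    by (intro density_cong) (auto simp: indicator_def divide_ennreal[symmetric])
  then have "integral\<^sup>L unif f = (\<integral>x. (indicator {-1..1} x / 2) *\<^sub>R f x \<partial>lborel)"
    by (simp only:) (rule integral_density, auto)
  also have "\<dots> = (\<integral>x. (f x * indicator {-1..1} x) / 2 \<partial>lborel)"
    by (intro Bochner_Integration.integral_cong) auto
  finally show ?thesis by simp
qed

lemma unif_moment: "integral\<^sup>L unif (\<lambda>x. x ^ k) = (if even k then 1 / (real k + 1) else 0)"
  by (subst integral_unif) (auto simp: integral_power divide_simps)

lemma unif_second_moment: "integral\<^sup>L unif (\<lambda>x. x\<^sup>2) = 1 / 3"
  by (simp add: unif_moment)

lemma distr_uminus_unif: "distr unif borel uminus = unif"
proof (rule measure_eqI)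
  fix A :: "real set" assume "A \<in> sets (distr unif borel uminus)"
  then have [measurable]: "A \<in> sets borel" by simp
  have [measurable]: "uminus -` A \<in> sets borel"
    using measurable_sets[of uminus borel borel A] by simp
  have "emeasure (distr unif borel uminus) A = emeasure lborel ({-1..1} \<inter> uminus -` A) / 2"
    by (subst emeasure_distr) (auto intro!: emeasure_uniform_measure[THEN trans])
  also have "emeasure lborel ({-1..1} \<inter> uminus -` A) = emeasure lborel (uminus -` ({-1..1} \<inter> A))"
    by (rule arg_cong[where f="emeasure lborel"]) auto
  also have "\<dots> = emeasure (distr lborel borel uminus) ({-1..1} \<inter> A)"
    by (subst emeasure_distr) auto
  also have "distr lborel borel uminus = (lborel :: real measure)"
    by (rule lborel_distr_uminus)
  finally show "emeasure (distr unif borel uminus) A = emeasure unif A"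
    by (simp)
qed simp

lemma char_unif_uminus: "char unif (- t) = char unif t"
proof -
  have "char (distr unif borel uminus) t = char unif (- t)"
    unfolding char_def by (subst integral_distr) auto
  then show ?thesis by (simp add: distr_uminus_unif)
qed

text \<open>On [-1,1] all absolute moments are at most 1, so the Taylor remainder of the
  characteristic function is at most \<open>2 * \<bar>t\<bar>^n / fact n\<close> and tends to 0.
  Hence the moments determine the characteristic function everywhere, and Levy uniqueness
  applies.\<close>

lemma bounded_moment_determinacy:
  fixes M N :: "real measure"
  assumes M: "real_distribution M" "AE x in M. \<bar>x\<bar> \<le> 1"
    and N: "real_distribution N" "AE x in N. \<bar>x\<bar> \<le> 1"
    and eq: "\<And>k. integral\<^sup>L M (\<lambda>x. x ^ k) = integral\<^sup>L N (\<lambda>x. x ^ k)"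
  shows "M = N"
proof (rule Levy_uniqueness[OF M(1) N(1)], rule ext)
  fix t :: real
  have approx: "(\<lambda>n. \<Sum>k\<le>n. ((\<i> * t)^k / fact k) * integral\<^sup>L L (\<lambda>x. x ^ k)) \<longlonglongrightarrow> char L t"
    if "real_distribution L" "AE x in L. \<bar>x\<bar> \<le> 1" for L :: "real measure"
  proof -
    interpret L: real_distribution L by fact
    have int: "integrable L (\<lambda>x. x ^ k)" "integrable L (\<lambda>x. \<bar>x\<bar> ^ k)" for k
    proof -
      have "AE x in L. \<bar>x\<bar> ^ k \<le> 1"
        using that(2) by eventually_elim (simp add: power_le_one)
      then show "integrable L (\<lambda>x. x ^ k)" "integrable L (\<lambda>x. \<bar>x\<bar> ^ k)"
        by (auto intro!: L.integrable_const_bound[where B=1] simp: power_abs)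
    qed
    have le: "L.expectation (\<lambda>x. \<bar>x\<bar>^n) \<le> 1" for n
    proof -
      have "AE x in L. \<bar>x\<bar>^n \<le> 1"
        using that(2) by eventually_elim (simp add: power_le_one)
      then show ?thesis
        using L.prob_space by (intro integral_mono_AE[THEN order_trans, OF int(2) _ , of "\<lambda>_. 1"]) auto
    qed
    have bd: "norm (char L t - (\<Sum>k\<le>n. ((\<i> * t)^k / fact k) * L.expectation (\<lambda>x. x^k)))
        \<le> 2 * (\<bar>t\<bar>^n / fact n)" for n
      using L.char_approx1[of n t] int mult_left_mono[OF le[of n], of "2*\<bar>t\<bar>^n / fact n"] by simp
    have "(\<lambda>n. \<bar>t\<bar>^n / fact n) \<longlonglongrightarrow> 0"
      using summable_LIMSEQ_zero[OF summable_exp_generic[of "\<bar>t\<bar>"]]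
      by (simp add: divide_inverse mult.commute)
    then have "(\<lambda>n. 2 * (\<bar>t\<bar>^n / fact n)) \<longlonglongrightarrow> 0"
      using tendsto_mult_right_zero by blast
    then have "(\<lambda>n. char L t - (\<Sum>k\<le>n. ((\<i> * t)^k / fact k) * L.expectation (\<lambda>x. x^k))) \<longlonglongrightarrow> 0"
      by (rule Lim_null_comparison[rotated]) (use bd in auto)
    from tendsto_diff[OF tendsto_const[of "char L t"] this] show ?thesis by simp
  qed
  show "char M t = char N t"
    using LIMSEQ_unique[OF approx[OF M] ] approx[OF N] by (simp add: eq)
qed

section \<open>Fourier uniqueness in the plane\<close>

text \<open>One-dimensional Levy uniqueness for the laws of \<open>X\<close> under the normalised
  densities \<open>w / c\<close>. Letting \<open>w\<close> depend on one coordinate and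
  \<open>X\<close> be the other allows the plane to be treated one coordinate at a time.\<close>

lemma weighted_Levy_uniqueness:
  fixes X :: "'a \<Rightarrow> real" and w :: "'a \<Rightarrow> real"
  assumes M: "prob_space M" and N: "prob_space N" and sets: "sets M = sets N"
    and X [measurable]: "X \<in> borel_measurable M"
    and w [measurable]: "w \<in> borel_measurable M"
    and w0: "\<And>x. 0 \<le> w x" and wB: "\<And>x. w x \<le> B"
    and eq: "\<And>t. (\<integral>x. w x *\<^sub>R iexp (t * X x) \<partial>M) = (\<integral>x. w x *\<^sub>R iexp (t * X x) \<partial>N)"
    and A: "A \<in> sets borel"
  shows "(\<integral>x. w x * indicator A (X x) \<partial>M) = (\<integral>x. w x * indicator A (X x) \<partial>N)"
proof -
  interpret M: prob_space M by fact
  interpret N: prob_space N by fact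
  note [measurable_cong] = sets
  have XN [measurable]: "X \<in> borel_measurable N" and wN [measurable]: "w \<in> borel_measurable N"
    using X w sets measurable_cong_sets by blast+
  have iM: "integrable M w"
    using w0 wB by (intro M.integrable_const_bound[where B=B]) auto
  have iN: "integrable N w"
    using w0 wB by (intro N.integrable_const_bound[where B=B]) auto
  define c where "c = integral\<^sup>L M w"
  \<comment> \<open>The case \<open>t = 0\<close> of \<open>eq\<close> compares the total weights,
    so a single normalising constant \<open>c\<close> serves both measures.\<close>
  have "complex_of_real (integral\<^sup>L M w) = complex_of_real (integral\<^sup>L N w)"
    using eq[of 0] by (simp add: integral_complex_of_real scaleR_conv_of_real)
  then have cN: "c = integral\<^sup>L N w" by (simp add: c_def)
  have c0: "0 \<le> c" unfolding c_def using w0 by (intro integral_nonneg_AE) auto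
  show ?thesis
  proof (cases "c = 0")
    case True
    have "AE x in M. w x = 0" "AE x in N. w x = 0"
      using integral_nonneg_eq_0_iff_AE[OF iM] integral_nonneg_eq_0_iff_AE[OF iN] w0 True cN c_def by auto
    then have "(\<integral>x. w x * indicator A (X x) \<partial>M) = 0" "(\<integral>x. w x * indicator A (X x) \<partial>N) = 0"
      by (auto intro!: integral_eq_zero_AE)
    then show ?thesis by simp
  next
    case False
    with c0 have c: "0 < c" by simp
    define D where "D L = distr (density L (\<lambda>x. ennreal (w x / c))) borel X" for L
    have D: "real_distribution (D L)" if "prob_space L" "sets L = sets M" "integrable L w" "integral\<^sup>L L w = c" for L
    proof -
      note [measurable_cong] = that(2)
      have [measurable]: "w \<in> borel_measurable L" "X \<in> borel_measurable L"
        using that(2) X w measurable_cong_sets by blast+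
      have "emeasure (density L (\<lambda>x. ennreal (w x / c))) (space L) = (\<integral>\<^sup>+x. ennreal (w x / c) \<partial>L)"
        by (subst emeasure_density) (auto intro!: nn_integral_cong)
      also have "\<dots> = ennreal (\<integral>x. w x / c \<partial>L)"
        using that w0 c by (intro nn_integral_eq_integral) auto
      also have "\<dots> = 1" using that c by simp
      finally have "prob_space (density L (\<lambda>x. ennreal (w x / c)))"
        by (intro prob_spaceI) simp
      then have "prob_space (D L)"
        unfolding D_def by (rule prob_space.prob_space_distr) simp
      then show ?thesis
        by (intro real_distribution.intro real_distribution_axioms.intro) (auto simp: D_def)
    qed
    have charD: "char (D L) t = (\<integral>x. w x *\<^sub>R iexp (t * X x) \<partial>L) / c"
      if "sets L = sets M" for L t
    proof -
      note [measurable_cong] = that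
      have [measurable]: "w \<in> borel_measurable L" "X \<in> borel_measurable L"
        using that X w measurable_cong_sets by blast+
      have "char (D L) t = (\<integral>x. (w x / c) *\<^sub>R iexp (t * X x) \<partial>L)"
        unfolding char_def D_def using w0 c
        by (subst integral_distr) (auto intro!: integral_density)
      also have "\<dots> = (\<integral>x. (w x *\<^sub>R iexp (t * X x)) / c \<partial>L)"
        by (simp add: scaleR_conv_of_real)
      finally show ?thesis by simp
    qed
    have intD: "integral\<^sup>L (D L) (indicat_real A) = (\<integral>x. w x * indicator A (X x) \<partial>L) / c"
      if "sets L = sets M" for L
    proof -
      note [measurable_cong] = that
      have [measurable]: "w \<in> borel_measurable L" "X \<in> borel_measurable L"
        using that X w measurable_cong_sets by blast+
      have "integral\<^sup>L (D L) (indicat_real A) = (\<integral>x. (w x / c) *\<^sub>R indicat_real A (X x) \<partial>L)"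
        unfolding D_def using w0 c A
        by (subst integral_distr) (auto simp: integral_density)
      also have "\<dots> = (\<integral>x. (w x * indicator A (X x)) / c \<partial>L)"
        by simp
      finally show ?thesis by simp
    qed
    have "D M = D N"
    proof (rule Levy_uniqueness)
      show "real_distribution (D M)" "real_distribution (D N)"
        using D M N sets iM iN cN c_def by auto
      show "char (D M) = char (D N)"
        by (rule ext) (simp only: charD[OF refl] charD[OF sets[symmetric]] eq)
    qed
    then have "(\<integral>x. w x * indicator A (X x) \<partial>M) / c = (\<integral>x. w x * indicator A (X x) \<partial>N) / c"
      using intD[of M] intD[of N] sets by simp
    then show ?thesis using c by simp
  qed
qed

lemma cos_affine_eq_iexp:
  "complex_of_real (cos (u + \<phi>)) = (cis \<phi> * iexp u + cis (- \<phi>) * iexp (- u)) / 2"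
  by (simp add: complex_eq_iff Re_exp Im_exp cos_add sin_add)

text \<open>The weighted one-dimensional result is applied twice: to \<open>fst\<close> with
  trigonometric weights in \<open>snd\<close>, whose transforms are combinations of planar
  characteristic function values, and then to \<open>snd\<close> with indicator weights in
  \<open>fst\<close>. This gives agreement on rectangles, which generate the Borel sets.\<close>

lemma Levy_uniqueness_plane:
  fixes M N :: "(real \<times> real) measure"
  assumes M: "prob_space M" and N: "prob_space N"
    and sM: "sets M = sets borel" and sN: "sets N = sets borel"
    and eq: "\<And>a b. (\<integral>p. iexp (a * fst p + b * snd p) \<partial>M) = (\<integral>p. iexp (a * fst p + b * snd p) \<partial>N)"
  shows "M = N"
proof -
  interpret M: prob_space M by fact
  interpret N: prob_space N by fact
  note [measurable_cong] = sM sN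
  have [measurable]: "fst \<in> borel_measurable M" "snd \<in> borel_measurable M" 
     "fst \<in> borel_measurable N" "snd \<in> borel_measurable N"
    by (simp_all add: measurable_cong_sets[OF sM refl] measurable_cong_sets[OF sN refl] borel_prod[symmetric])
  have I: "integrable M (\<lambda>p. iexp (a * fst p + b * snd p))" "integrable N (\<lambda>p. iexp (a * fst p + b * snd p))" for a b
    by (auto intro!: M.integrable_const_bound[where B=1] N.integrable_const_bound[where B=1] simp del: of_real_add of_real_mult)
  \<comment> \<open>The summand 1 makes the cosine a nonnegative weight, as
    \<open>weighted_Levy_uniqueness\<close> demands.\<close>
  have cos_weight: "(\<integral>p. (1 + cos (b * snd p + \<phi>)) * indicator A (fst p) \<partial>M)
      = (\<integral>p. (1 + cos (b * snd p + \<phi>)) * indicator A (fst p) \<partial>N)" if "A \<in> sets borel" for A b \<phi>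
  proof (rule weighted_Levy_uniqueness[OF M N _ _ _ _ _ _ that, where B=2 and X=fst and w="\<lambda>p. 1 + cos (b * snd p + \<phi>)"])
    fix p :: "real \<times> real"
    show "0 \<le> 1 + cos (b * snd p + \<phi>)" "1 + cos (b * snd p + \<phi>) \<le> 2"
      using cos_ge_minus_one[of "b * snd p + \<phi>"] cos_le_one[of "b * snd p + \<phi>"] by linarith+
  next
    fix t :: real
    have e: "(1 + cos (b * snd p + \<phi>)) *\<^sub>R iexp (t * fst p) =
       iexp (t * fst p + 0 * snd p) + (cis \<phi> / 2) * iexp (t * fst p + b * snd p)
        + (cis (- \<phi>) / 2) * iexp (t * fst p + (- b) * snd p)" for p :: "real \<times> real"
    proof -
      have split: "iexp (u + v) = iexp u * iexp v" for u v
        by (simp add: exp_add distrib_left)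
      have "(1 + (c * Y + d * Z) / 2) * X = X * iexp 0 + (c / 2) * (X * Y) + (d / 2) * (X * Z)"
        for X Y Z c d :: complex
        by (simp add: field_simps)
      then show ?thesis
        unfolding scaleR_conv_of_real of_real_add[of 1] cos_affine_eq_iexp of_real_1 split
          mult_zero_left mult_minus_left .
    qed
    show "(\<integral>p. (1 + cos (b * snd p + \<phi>)) *\<^sub>R iexp (t * fst p) \<partial>M)
       = (\<integral>p. (1 + cos (b * snd p + \<phi>)) *\<^sub>R iexp (t * fst p) \<partial>N)"
      unfolding e using I
      by (simp only: Bochner_Integration.integral_add Bochner_Integration.integrable_add
          integrable_mult_right integral_mult_right_zero eq)
  qed (use sM sN in auto)
  have fst_weight: "(\<integral>p. indicator A (fst p) * indicator B (snd p) \<partial>M)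
      = (\<integral>p. indicator A (fst p) * indicator B (snd p) \<partial>N :: real)"
    if A [measurable]: "A \<in> sets borel" and B: "B \<in> sets borel" for A B :: "real set"
  proof (rule weighted_Levy_uniqueness[OF M N _ _ _ _ _ _ B, where B=1 and X=snd and w="\<lambda>p. indicator A (fst p)"])
    fix t :: real
    have cosI: "(\<integral>p. indicator A (fst p) * cos (t * snd p + \<phi>) \<partial>M)
       = (\<integral>p. indicator A (fst p) * cos (t * snd p + \<phi>) \<partial>N)" for \<phi>
    proof -
      \<comment> \<open>With frequency 0 and phase \<open>pi / 2\<close> the cosine vanishes, so the
        subtracted term is the plain indicator and cancels the summand 1.\<close>
      have e: "indicator A (fst p) * cos (t * snd p + \<phi>) =
        (1 + cos (t * snd p + \<phi>)) * indicator A (fst p)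
          - (1 + cos (0 * snd p + pi / 2)) * indicator A (fst p)" for p :: "real \<times> real"
        by (simp add: algebra_simps)
      have bd: "\<bar>1 + cos u\<bar> \<le> 2" for u :: real
        using cos_ge_minus_one[of u] cos_le_one[of u] by linarith
      have iM: "integrable M (\<lambda>p. (1 + cos (b * snd p + \<psi>)) * indicator A (fst p))" for b \<psi>
        using bd by (intro M.integrable_const_bound[where B=2]) (auto simp: indicator_def)
      have iN: "integrable N (\<lambda>p. (1 + cos (b * snd p + \<psi>)) * indicator A (fst p))" for b \<psi>
        using bd by (intro N.integrable_const_bound[where B=2]) (auto simp: indicator_def)
      show ?thesis
        unfolding e using iM iN by (simp only: Bochner_Integration.integral_diff cos_weight[OF A])
    qed
    \<comment> \<open>The phases 0 and \<open>- pi / 2\<close> produce the real part and the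
      imaginary part.\<close>
    have e: "indicator A (fst p) *\<^sub>R iexp (t * snd p) =
       complex_of_real (indicator A (fst p) * cos (t * snd p + 0)) +
       \<i> * complex_of_real (indicator A (fst p) * cos (t * snd p + (- pi / 2)))" for p :: "real \<times> real"
      by (simp add: complex_eq_iff Re_exp Im_exp cos_diff indicator_def)
    have iM: "integrable M (\<lambda>p. indicator A (fst p) * cos (t * snd p + \<psi>))" for \<psi>
      by (intro M.integrable_const_bound[where B=1]) (auto simp: indicator_def)
    have iN: "integrable N (\<lambda>p. indicator A (fst p) * cos (t * snd p + \<psi>))" for \<psi>
      by (intro N.integrable_const_bound[where B=1]) (auto simp: indicator_def)
    show "(\<integral>p. indicator A (fst p) *\<^sub>R iexp (t * snd p) \<partial>M) = (\<integral>p. indicator A (fst p) *\<^sub>R iexp (t * snd p) \<partial>N)"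
      unfolding e using iM iN cosI
      by (simp only: Bochner_Integration.integral_add integrable_of_real integrable_mult_right
          integral_complex_of_real integral_mult_right_zero)
  qed (use sM sN in \<open>auto simp: indicator_def\<close>)
  have rect: "emeasure M (A \<times> B) = emeasure N (A \<times> B)"
    if [measurable]: "A \<in> sets borel" "B \<in> sets borel" for A B :: "real set"
  proof -
    have [measurable]: "A \<times> B \<in> sets M" "A \<times> B \<in> sets N"
      by (simp_all add: sM sN borel_Times)
    have e: "indicator A (fst p) * indicator B (snd p) = (indicator (A \<times> B) p :: real)" for p :: "real \<times> real"
      by (cases p) (simp add: indicator_times)
    show ?thesis
      using fst_weight[OF that] unfolding e
      by (simp add: M.emeasure_eq_measure N.emeasure_eq_measure)
  qed
  let ?E = "{a \<times> b | a b :: real set. a \<in> sets borel \<and> b \<in> sets borel}"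
  have gen: "sets (borel :: (real \<times> real) measure) = sigma_sets UNIV ?E"
    unfolding borel_prod[symmetric] by (subst sets_pair_measure) simp
  show ?thesis
  proof (rule measure_eqI_generator_eq[where E="?E" and \<Omega>=UNIV and A="\<lambda>_. UNIV"])
    show "Int_stable ?E" by (rule Int_stable_pair_measure_generator)
    show "range (\<lambda>_. UNIV) \<subseteq> ?E" by (auto intro!: exI[of _ UNIV])
  qed (use rect gen sM sN in auto)
qed

section \<open>The Archimedean measure\<close>

lemma integrable_unif:
  fixes f :: "real \<Rightarrow> real"
  assumes "continuous_on UNIV f"
  shows "integrable unif f"
proof -
  interpret prob_space unif by (rule prob_space_unif)
  have "compact (f ` {-1..1})"
    by (intro compact_continuous_image continuous_on_subset[OF assms]) auto
  then obtain B where B: "\<And>x. x \<in> {-1..1} \<Longrightarrow> norm (f x) \<le> B"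
    by (force dest!: compact_imp_bounded simp: bounded_iff)
  have "AE x in unif. norm (f x) \<le> B"
    using AE_unif by eventually_elim (rule B)
  moreover have "f \<in> borel_measurable unif"
    using borel_measurable_continuous_onI[OF assms] by simp
  ultimately show ?thesis by (intro integrable_const_bound)
qed

lemma integral_unif_FTC:
  fixes f F :: "real \<Rightarrow> real"
  assumes "\<And>x. (F has_real_derivative f x) (at x)" and f: "continuous_on UNIV f"
  shows "integral\<^sup>L unif f = (F 1 - F (-1)) / 2"
proof -
  have "(\<integral>x. f x * indicator {-1..1} x \<partial>lborel) = F 1 - F (-1)"
    using f by (intro integral_FTC_Icc_real assms) (auto simp: continuous_on_eq_continuous_at)
  then show ?thesis
    using borel_measurable_continuous_onI[OF f] by (simp add: integral_unif)
qed

text \<open>Integrate the derivative of \<open>u * (1 - u\<^sup>2) ^ Suc n\<close>, a function that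
  vanishes at both ends of [-1,1].\<close>

lemma unif_radial_recursion:
  "(2 * real n + 3) * integral\<^sup>L unif (\<lambda>u. (1 - u\<^sup>2) ^ Suc n) = (2 * real n + 2) * integral\<^sup>L unif (\<lambda>u. (1 - u\<^sup>2) ^ n)"
proof -
  have int: "integrable unif (\<lambda>u. (1 - u\<^sup>2) ^ n)" for n
    by (intro integrable_unif continuous_intros)
  let ?f = "\<lambda>u. (2 * real n + 3) * (1 - u\<^sup>2) ^ Suc n - (2 * real n + 2) * (1 - u\<^sup>2) ^ n"
  have der: "((\<lambda>u. u * (1 - u\<^sup>2) ^ Suc n) has_real_derivative ?f u) (at u)" for u
  proof -
    have "((\<lambda>u. u * (1 - u\<^sup>2) ^ Suc n) has_real_derivative
        (1 - u\<^sup>2) ^ Suc n - (2 * real n + 2) * u\<^sup>2 * (1 - u\<^sup>2) ^ n) (at u)"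
      by (rule derivative_eq_intros refl)+ (simp_all add: algebra_simps power2_eq_square)
    then show ?thesis by (simp add: algebra_simps)
  qed
  have "integral\<^sup>L unif ?f = 0"
    by (subst integral_unif_FTC[OF der]) (auto intro!: continuous_intros)
  then show ?thesis
    using int[of n] int[of "Suc n"] by (simp del: power_Suc)
qed

text \<open>Integrate the derivative of sine times a power of cosine. As \<open>v\<close> runs from
  -1 to 1 the argument runs through a full period, so the boundary terms cancel.\<close>

lemma unif_cos_recursion:
  "(real k + 2) * integral\<^sup>L unif (\<lambda>v. cos (pi * v - \<phi>) ^ (k + 2))
    = (real k + 1) * integral\<^sup>L unif (\<lambda>v. cos (pi * v - \<phi>) ^ k)"
proof -
  have int: "integrable unif (\<lambda>v. cos (pi * v - \<phi>) ^ n)" for n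
    by (intro integrable_unif continuous_intros)
  let ?f = "\<lambda>v. (real k + 2) * cos (pi * v - \<phi>) ^ (k + 2) - (real k + 1) * cos (pi * v - \<phi>) ^ k"
  have der: "((\<lambda>v. sin (pi * v - \<phi>) * cos (pi * v - \<phi>) ^ Suc k / pi) has_real_derivative ?f v) (at v)" for v
  proof -
    have s: "sin (pi * v - \<phi>) * sin (pi * v - \<phi>) = 1 - cos (pi * v - \<phi>) * cos (pi * v - \<phi>)"
      using sin_cos_squared_add3[of "pi * v - \<phi>"] by linarith
    have "((\<lambda>v. sin (pi * v - \<phi>) * cos (pi * v - \<phi>) ^ Suc k / pi) has_real_derivative
       cos (pi * v - \<phi>) * cos (pi * v - \<phi>) ^ Suc k
        - (real k + 1) * (sin (pi * v - \<phi>) * sin (pi * v - \<phi>)) * cos (pi * v - \<phi>) ^ k) (at v)"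
      by (rule derivative_eq_intros refl)+ (simp_all add: field_simps)
    then show ?thesis unfolding s by (simp add: algebra_simps)
  qed
  have "integral\<^sup>L unif ?f = 0"
    by (subst integral_unif_FTC[OF der]) (auto intro!: continuous_intros simp: sin_diff cos_diff)
  then show ?thesis
    using int[of k] int[of "k + 2"] by (simp del: power_Suc)
qed

text \<open>This is the theorem of Archimedes on sphere and cylinder in terms of moments: on the
  unit sphere, a point of height \<open>u\<close> and longitude \<open>pi * v\<close> has horizontal
  coordinates of this form. In even degree the two recursions multiply to
  \<open>(2n+1)/(2n+3)\<close>, and induction gives \<open>1/(2n+1)\<close>; in odd degree the
  cosine factor is 0.\<close>

lemma archimedean_moment:
  "integral\<^sup>L unif (\<lambda>u. sqrt (1 - u\<^sup>2) ^ k) * integral\<^sup>L unif (\<lambda>v. cos (pi * v - \<phi>) ^ k)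
    = integral\<^sup>L unif (\<lambda>x. x ^ k)"
proof (cases "even k")
  case True
  then obtain n where k: "k = 2 * n" by blast
  have sq: "integral\<^sup>L unif (\<lambda>u. sqrt (1 - u\<^sup>2) ^ (2 * n)) = integral\<^sup>L unif (\<lambda>u. (1 - u\<^sup>2) ^ n)" for n
  proof (rule integral_cong_AE)
    \<comment> \<open>Outside [-1,1] the radicand is negative and the identity can fail, so it is
      claimed only almost everywhere.\<close>
    show "AE u in unif. sqrt (1 - u\<^sup>2) ^ (2 * n) = (1 - u\<^sup>2) ^ n"
      using AE_unif
    proof eventually_elim
      case (elim u)
      then have "u\<^sup>2 \<le> 1" by (simp add: abs_square_le_1 abs_le_iff)
      then show ?case by (simp add: power_mult)
    qed
  qed auto
  have "integral\<^sup>L unif (\<lambda>u. (1 - u\<^sup>2) ^ n) * integral\<^sup>L unif (\<lambda>v. cos (pi * v - \<phi>) ^ (2 * n)) = 1 / (2 * real n + 1)"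
  proof (induction n)
    case 0
    then show ?case using prob_space.prob_space[OF prob_space_unif] by simp
  next
    case (Suc n)
    have "(2 * real n + 2) * (2 * real n + 3) *
      (integral\<^sup>L unif (\<lambda>u. (1 - u\<^sup>2) ^ Suc n) * integral\<^sup>L unif (\<lambda>v. cos (pi * v - \<phi>) ^ (2 * Suc n)))
      = ((2 * real n + 3) * integral\<^sup>L unif (\<lambda>u. (1 - u\<^sup>2) ^ Suc n)) *
        ((real (2 * n) + 2) * integral\<^sup>L unif (\<lambda>v. cos (pi * v - \<phi>) ^ (2 * n + 2)))"
      by (simp del: power_Suc)
    also have "\<dots> = (2 * real n + 2) * ((2 * real n + 1) *
       (integral\<^sup>L unif (\<lambda>u. (1 - u\<^sup>2) ^ n) * integral\<^sup>L unif (\<lambda>v. cos (pi * v - \<phi>) ^ (2 * n))))"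
      unfolding unif_radial_recursion unif_cos_recursion by simp
    also have "\<dots> = 2 * real n + 2"
      unfolding Suc.IH by (simp add: field_simps)
    finally have "(2 * real n + 3) *
      (integral\<^sup>L unif (\<lambda>u. (1 - u\<^sup>2) ^ Suc n) * integral\<^sup>L unif (\<lambda>v. cos (pi * v - \<phi>) ^ (2 * Suc n))) = 1"
      by (simp del: power_Suc add: mult.assoc)
    then show ?case by (simp del: power_Suc mult_Suc_right add: field_simps)
  qed
  then show ?thesis by (simp add: k sq unif_moment)
next
  case False
  then obtain n where k: "k = 2 * n + 1" by (elim oddE)
  have "integral\<^sup>L unif (\<lambda>v. cos (pi * v - \<phi>) ^ (2 * n + 1)) = 0"
  proof (induction n)
    case 0
    have "integral\<^sup>L unif (\<lambda>v. cos (pi * v - \<phi>)) = 0"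
      by (subst integral_unif_FTC[where F="\<lambda>v. sin (pi * v - \<phi>) / pi"])
         (auto intro!: derivative_eq_intros continuous_intros simp: sin_diff cos_diff field_simps)
    then show ?case by simp
  next
    case (Suc n)
    then show ?case
      using unif_cos_recursion[of "2 * n + 1" \<phi>] by (simp add: add_eq_0_iff)
  qed
  then have "integral\<^sup>L unif (\<lambda>v. cos (pi * v - \<phi>) ^ k) = 0" by (simp only: k)
  moreover have "integral\<^sup>L unif (\<lambda>x. x ^ k) = 0" using False by (simp only: unif_moment if_False)
  ultimately show ?thesis by simp
qed

text \<open>This is the predicate under the \<open>THE\<close> in
  \<open>archimedean_measure\<close>; existence and uniqueness are proved for it below.\<close>

definition uniform_projections :: "(real \<times> real) measure \<Rightarrow> bool" where
  "uniform_projections M \<longleftrightarrow> prob_space M \<and> sets M = sets borel \<and>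
     (\<forall>u. norm u = 1 \<longrightarrow> distr M borel (\<lambda>p. p \<bullet> u) = unif)"

text \<open>In polar coordinates \<open>(a, b)\<close> is \<open>r\<close> times a unit vector, so
  the integral is the characteristic function of one projection at \<open>r\<close>. It follows that
  the uniform projections fix the whole planar characteristic function.\<close>

lemma uniform_projections_char:
  assumes "uniform_projections M"
  shows "(\<integral>p. iexp (a * fst p + b * snd p) \<partial>M) = char unif (sqrt (a\<^sup>2 + b\<^sup>2))"
proof -
  obtain r \<phi> where \<phi>: "a = r * cos \<phi>" "b = r * sin \<phi>"
    using polar_Ex[of a b] by metis
  have "a\<^sup>2 + b\<^sup>2 = r\<^sup>2"
    unfolding \<phi> power_mult_distrib distrib_left[symmetric] by simp
  \<comment> \<open>The root is the absolute value of \<open>r\<close>; the sign does not matter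
    because the uniform distribution is symmetric.\<close>
  then have r: "char unif (sqrt (a\<^sup>2 + b\<^sup>2)) = char unif r"
    using char_unif_uminus[of r] by (simp add: abs_if)
  have [measurable_cong]: "sets M = sets borel"
    using assms by (simp add: uniform_projections_def)
  have "norm (cos \<phi>, sin \<phi>) = 1" by (simp add: norm_Pair)
  then have "unif = distr M borel (\<lambda>p. p \<bullet> (cos \<phi>, sin \<phi>))"
    using assms by (simp add: uniform_projections_def)
  then have "char unif r = char (distr M borel (\<lambda>p. p \<bullet> (cos \<phi>, sin \<phi>))) r" by simp
  also have "\<dots> = (\<integral>p. iexp (r * (p \<bullet> (cos \<phi>, sin \<phi>))) \<partial>M)"
    unfolding char_def by (rule integral_distr) auto
  also have "\<dots> = (\<integral>p. iexp (a * fst p + b * snd p) \<partial>M)"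
    by (simp add: inner_prod_def \<phi> algebra_simps)
  finally show ?thesis by (simp add: r)
qed

lemma uniform_projections_unique:
  assumes M: "uniform_projections M" and N: "uniform_projections N"
  shows "M = N"
  using M N by (intro Levy_uniqueness_plane)
    (simp_all only: uniform_projections_char, simp_all add: uniform_projections_def)

text \<open>The witness is the law of the orthogonal projection to the equatorial plane of a uniform
  point on the unit sphere, given by an independent height \<open>u\<close> and longitude
  \<open>pi * v\<close>. Its projection to any line is bounded by 1 and has the moments of
  \<open>unif\<close>, which suffices by \<open>bounded_moment_determinacy\<close>.\<close>

lemma uniform_projections_exists: "\<exists>M. uniform_projections M"
proof -
  let ?P = "unif \<Otimes>\<^sub>M unif"
  let ?T = "\<lambda>(u, v). (sqrt (1 - u\<^sup>2) * cos (pi * v), sqrt (1 - u\<^sup>2) * sin (pi * v))"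
  interpret U: prob_space unif by (rule prob_space_unif)
  interpret P: pair_prob_space unif unif ..
  have [measurable_cong]: "sets ?P = sets (borel \<Otimes>\<^sub>M borel)"
    by (intro sets_pair_measure_cong sets_unif)
  have T [measurable]: "?T \<in> borel_measurable ?P"
    unfolding borel_prod[symmetric] by measurable
  define M where "M = distr ?P borel ?T"
  have bound: "\<bar>sqrt (1 - u\<^sup>2) * cos t\<bar> \<le> 1" if "u \<in> {-1..1}" for u t :: real
  proof -
    have "\<bar>sqrt (1 - u\<^sup>2)\<bar> \<le> 1" using that by (simp add: abs_square_le_1 abs_le_iff)
    then show ?thesis unfolding abs_mult by (intro mult_le_one) auto
  qed
  have AE_P: "AE p in ?P. fst p \<in> {-1..1}"
  proof (rule P.AE_pair_measure)
    show "{p \<in> space ?P. fst p \<in> {-1..1}} \<in> sets ?P" by measurable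
  qed (use AE_unif in auto)
  have "distr M borel (\<lambda>p. p \<bullet> u) = unif" if u: "norm u = 1" for u
  proof -
    obtain \<phi> where \<phi>: "u = (cos \<phi>, sin \<phi>)"
    proof -
      have "(fst u)\<^sup>2 + (snd u)\<^sup>2 = 1"
        using u by (cases u) (simp add: norm_Pair)
      then show ?thesis
        using sincos_total_2pi_le[of "fst u" "snd u"] that by (metis prod.collapse)
    qed
    define f where "f = (\<lambda>(u::real, v). sqrt (1 - u\<^sup>2) * cos (pi * v - \<phi>))"
    have f [measurable]: "f \<in> borel_measurable ?P"
      unfolding f_def by measurable
    have "distr M borel (\<lambda>p. p \<bullet> u) = distr ?P borel ((\<lambda>p. p \<bullet> u) \<circ> ?T)"
      unfolding M_def by (rule distr_distr) auto
    also have "(\<lambda>p. p \<bullet> u) \<circ> ?T = f"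
      by (auto simp: fun_eq_iff \<phi> f_def cos_diff algebra_simps)
    finally have D: "distr M borel (\<lambda>p. p \<bullet> u) = distr ?P borel f" .
    have AE_f: "AE p in ?P. \<bar>f p\<bar> \<le> 1"
      using AE_P by eventually_elim (auto simp: f_def split_beta intro!: bound)
    have "distr ?P borel f = unif"
    proof (rule bounded_moment_determinacy[OF _ _ real_distribution_unif])
      show "real_distribution (distr ?P borel f)"
        by (intro real_distribution.intro P.prob_space_distr real_distribution_axioms.intro) auto
      show "AE x in distr ?P borel f. \<bar>x\<bar> \<le> 1" using AE_f by (simp add: AE_distr_iff)
      show "AE x in unif. \<bar>x\<bar> \<le> 1" using AE_unif by eventually_elim auto
      fix k
      have "AE p in ?P. norm (f p ^ k) \<le> 1"
        using AE_f by eventually_elim (simp add: power_abs power_le_one)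
      then have int: "integrable ?P (\<lambda>p. f p ^ k)"
        by (intro P.integrable_const_bound) auto
      have fk: "(\<lambda>p. f p ^ k) = (\<lambda>(u, v). sqrt (1 - u\<^sup>2) ^ k * cos (pi * v - \<phi>) ^ k)"
        by (auto simp: fun_eq_iff f_def power_mult_distrib)
      have "integral\<^sup>L (distr ?P borel f) (\<lambda>x. x ^ k) = integral\<^sup>L ?P (\<lambda>p. f p ^ k)"
        by (rule integral_distr) auto
      also have "\<dots> = integral\<^sup>L ?P (\<lambda>(u, v). sqrt (1 - u\<^sup>2) ^ k * cos (pi * v - \<phi>) ^ k)"
        unfolding fk ..
      also have "\<dots> = (\<integral>u. (\<integral>v. sqrt (1 - u\<^sup>2) ^ k * cos (pi * v - \<phi>) ^ k \<partial>unif) \<partial>unif)"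
        using int unfolding fk by (intro P.integral_fst[symmetric])
      also have "\<dots> = integral\<^sup>L unif (\<lambda>u. sqrt (1 - u\<^sup>2) ^ k) * integral\<^sup>L unif (\<lambda>v. cos (pi * v - \<phi>) ^ k)"
        by simp
      also have "\<dots> = integral\<^sup>L unif (\<lambda>x. x ^ k)" by (rule archimedean_moment)
      finally show "integral\<^sup>L (distr ?P borel f) (\<lambda>x. x ^ k) = integral\<^sup>L unif (\<lambda>x. x ^ k)" .
    qed
    with D show ?thesis by simp
  qed
  then have "uniform_projections M"
    unfolding uniform_projections_def by (auto simp: M_def intro!: P.prob_space_distr)
  then show ?thesis ..
qed

lemma uniform_projections_archimedean: "uniform_projections archimedean_measure"
  unfolding archimedean_measure_def uniform_projections_def[symmetric]
  by (rule theI') (use uniform_projections_exists uniform_projections_unique in blast)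

section \<open>Permutons and their couplings\<close>

lemma measurable_fst_borel [measurable]: "fst \<in> borel \<rightarrow>\<^sub>M borel"
  by (intro borel_measurable_continuous_onI continuous_intros)

lemma measurable_snd_borel [measurable]: "snd \<in> borel \<rightarrow>\<^sub>M borel"
  by (intro borel_measurable_continuous_onI continuous_intros)

lemma (in prob_space) integral_Cauchy_Schwarz:
  fixes f g :: "'a \<Rightarrow> real"
  assumes "integrable M (\<lambda>x. (f x)\<^sup>2)" "integrable M (\<lambda>x. (g x)\<^sup>2)" "integrable M (\<lambda>x. f x * g x)"
  shows "\<bar>expectation (\<lambda>x. f x * g x)\<bar> \<le> sqrt (expectation (\<lambda>x. (f x)\<^sup>2)) * sqrt (expectation (\<lambda>x. (g x)\<^sup>2))"
proof -
  let ?A = "expectation (\<lambda>x. (f x)\<^sup>2)" and ?B = "expectation (\<lambda>x. (g x)\<^sup>2)" and ?C = "expectation (\<lambda>x. f x * g x)"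
  have q: "0 \<le> s\<^sup>2 * ?A + 2 * s * t * ?C + t\<^sup>2 * ?B" for s t
  proof -
    have "0 \<le> expectation (\<lambda>x. (s * f x + t * g x)\<^sup>2)" by simp
    also have "(\<lambda>x. (s * f x + t * g x)\<^sup>2) = (\<lambda>x. s\<^sup>2 * (f x)\<^sup>2 + 2 * s * t * (f x * g x) + t\<^sup>2 * (g x)\<^sup>2)"
      by (auto simp: power2_eq_square algebra_simps)
    also have "expectation \<dots> = s\<^sup>2 * ?A + 2 * s * t * ?C + t\<^sup>2 * ?B"
      using assms by simp
    finally show ?thesis .
  qed
  have A0: "0 \<le> ?A" and B0: "0 \<le> ?B" by simp_all
  have "?C\<^sup>2 \<le> ?A * ?B"
  proof (cases "?A = 0")
    case True
    have "?C = 0"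
    proof (rule ccontr)
      assume "?C \<noteq> 0"
      \<comment> \<open>With \<open>?A = 0\<close> the form is affine in \<open>s\<close>; this
        choice of \<open>s\<close> with \<open>t = 1\<close> gives it the value -1.\<close>
      then show False
        using q[of "- (?B + 1) / (2 * ?C)" 1] True by (simp add: field_simps)
    qed
    then show ?thesis using True by simp
  next
    case False
    then have A: "0 < ?A" using A0 by (metis less_eq_real_def)
    \<comment> \<open>At \<open>s = - ?C\<close>, \<open>t = ?A\<close> the form is
      \<open>?A\<close> times the determinant.\<close>
    have "0 \<le> ?A * (?A * ?B - ?C\<^sup>2)"
      using q[of "- ?C" ?A] by (simp add: power2_eq_square algebra_simps)
    then show ?thesis using A by (simp add: zero_le_mult_iff)
  qed
  then have "sqrt (?C\<^sup>2) \<le> sqrt (?A * ?B)" by (rule real_sqrt_le_mono)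
  then show ?thesis by (simp add: real_sqrt_mult)
qed

section \<open>Diagonal coordinates, second moments and the angle of a permuton\<close>

definition diag :: "real \<times> real \<Rightarrow> real" where "diag p = (fst p + snd p) / 2"
definition anti :: "real \<times> real \<Rightarrow> real" where "anti p = (snd p - fst p) / 2"

lemma measurable_diag [measurable]: "diag \<in> borel_measurable borel"
  unfolding diag_def[abs_def] by measurable

lemma measurable_anti [measurable]: "anti \<in> borel_measurable borel"
  unfolding anti_def[abs_def] by measurable

text \<open>Up to sign conventions, \<open>diag\<close> and \<open>anti\<close> arise by turning the
  plane by 45 degrees and shrinking it by \<open>sqrt 2\<close>, whence the factor 2.\<close>

lemma norm_sq_diag_anti: "(norm (p - q))\<^sup>2 = 2 * ((diag p - diag q)\<^sup>2 + (anti p - anti q)\<^sup>2)"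
proof -
  have "(norm x)\<^sup>2 = (fst x)\<^sup>2 + (snd x)\<^sup>2" for x :: "real \<times> real"
    by (cases x) (simp add: norm_Pair)
  then show ?thesis by (simp add: diag_def anti_def power2_eq_square field_simps)
qed

context
  fixes \<mu> :: "(real \<times> real) measure"
  assumes \<mu>: "\<mu> \<in> permutons"
begin

lemma permuton_prob_space: "prob_space \<mu>"
  using \<mu> by (simp add: permutons_def)

lemma permuton_sets: "sets \<mu> = sets borel"
  using \<mu> by (simp add: permutons_def)

lemma permuton_marginals: "distr \<mu> borel fst = unif" "distr \<mu> borel snd = unif"
  using \<mu> by (simp_all add: permutons_def)

lemma permuton_AE: "AE p in \<mu>. fst p \<in> {-1..1} \<and> snd p \<in> {-1..1}"
proof -
  note [measurable_cong] = permuton_sets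
  have "AE x in distr \<mu> borel fst. x \<in> {-1..1}" "AE x in distr \<mu> borel snd. x \<in> {-1..1}"
    using AE_unif by (simp_all only: permuton_marginals)
  then show ?thesis by (simp add: AE_distr_iff)
qed

lemma permuton_AE_diag_anti: "AE p in \<mu>. \<bar>diag p\<bar> \<le> 1 \<and> \<bar>anti p\<bar> \<le> 1"
  using permuton_AE by eventually_elim (auto simp: diag_def anti_def)

lemma permuton_integrable:
  "integrable \<mu> (\<lambda>p. (fst p)\<^sup>2)" "integrable \<mu> (\<lambda>p. (snd p)\<^sup>2)"
  "integrable \<mu> (\<lambda>p. (diag p)\<^sup>2)" "integrable \<mu> (\<lambda>p. (anti p)\<^sup>2)"
proof -
  note [measurable_cong] = permuton_sets
  interpret prob_space \<mu> by (rule permuton_prob_space)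
  have "AE p in \<mu>. (fst p)\<^sup>2 \<le> 1 \<and> (snd p)\<^sup>2 \<le> 1 \<and> (diag p)\<^sup>2 \<le> 1 \<and> (anti p)\<^sup>2 \<le> 1"
    using permuton_AE permuton_AE_diag_anti
    by eventually_elim (auto simp: abs_square_le_1 abs_le_iff)
  then show "integrable \<mu> (\<lambda>p. (fst p)\<^sup>2)" "integrable \<mu> (\<lambda>p. (snd p)\<^sup>2)"
    "integrable \<mu> (\<lambda>p. (diag p)\<^sup>2)" "integrable \<mu> (\<lambda>p. (anti p)\<^sup>2)"
    by (auto intro!: integrable_const_bound[where B=1])
qed

text \<open>The sum of the squares of both coordinates is half the squared norm, and its mean
  depends on the marginals alone, each of which has second moment 1/3.\<close>

lemma permuton_second_moments:
  "integral\<^sup>L \<mu> (\<lambda>p. (diag p)\<^sup>2) + integral\<^sup>L \<mu> (\<lambda>p. (anti p)\<^sup>2) = 1 / 3"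
proof -
  note [measurable_cong] = permuton_sets
  have "integral\<^sup>L \<mu> (\<lambda>p. (fst p)\<^sup>2) = integral\<^sup>L (distr \<mu> borel fst) (\<lambda>x. x\<^sup>2)"
    "integral\<^sup>L \<mu> (\<lambda>p. (snd p)\<^sup>2) = integral\<^sup>L (distr \<mu> borel snd) (\<lambda>x. x\<^sup>2)"
    by (simp_all add: integral_distr)
  then have *: "integral\<^sup>L \<mu> (\<lambda>p. (fst p)\<^sup>2) = 1 / 3" "integral\<^sup>L \<mu> (\<lambda>p. (snd p)\<^sup>2) = 1 / 3"
    by (simp_all add: permuton_marginals unif_second_moment)
  have "integral\<^sup>L \<mu> (\<lambda>p. (diag p)\<^sup>2) + integral\<^sup>L \<mu> (\<lambda>p. (anti p)\<^sup>2)
     = integral\<^sup>L \<mu> (\<lambda>p. (diag p)\<^sup>2 + (anti p)\<^sup>2)"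
    using permuton_integrable by simp
  also have "(\<lambda>p. (diag p)\<^sup>2 + (anti p)\<^sup>2) = (\<lambda>p. ((fst p)\<^sup>2 + (snd p)\<^sup>2) / 2)"
    by (auto simp: diag_def anti_def power2_eq_square field_simps)
  also have "integral\<^sup>L \<mu> \<dots> = 1 / 3"
    using permuton_integrable * by simp
  finally show ?thesis .
qed

end

text \<open>The \<open>L\<^sup>2\<close> norms of \<open>diag\<close> and \<open>anti\<close> form a
  point on the quarter circle of radius \<open>1 / sqrt 3\<close>; the factor 3 normalises that
  radius, and the angle is measured from the \<open>diag\<close> axis.\<close>

definition angle :: "(real \<times> real) measure \<Rightarrow> real" where
  "angle \<mu> = arccos (sqrt (3 * integral\<^sup>L \<mu> (\<lambda>p. (diag p)\<^sup>2)))"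

lemma permuton_angle:
  assumes "\<mu> \<in> permutons"
  shows "angle \<mu> \<in> {0..pi / 2}"
    and "integral\<^sup>L \<mu> (\<lambda>p. (diag p)\<^sup>2) = (cos (angle \<mu>))\<^sup>2 / 3"
    and "integral\<^sup>L \<mu> (\<lambda>p. (anti p)\<^sup>2) = (sin (angle \<mu>))\<^sup>2 / 3"
proof -
  let ?A = "integral\<^sup>L \<mu> (\<lambda>p. (diag p)\<^sup>2)" and ?B = "integral\<^sup>L \<mu> (\<lambda>p. (anti p)\<^sup>2)"
  have AB: "0 \<le> ?A" "0 \<le> ?B" "?A + ?B = 1 / 3"
    using permuton_second_moments[OF assms] by auto
  then have "3 * ?A \<le> 1" by linarith
  then have *: "0 \<le> sqrt (3 * ?A)" "sqrt (3 * ?A) \<le> 1" by auto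
  have **: "- 1 \<le> sqrt (3 * ?A)" by (rule order_trans[OF _ *(1)]) simp
  show "angle \<mu> \<in> {0..pi / 2}"
    unfolding angle_def atLeastAtMost_iff
    using arccos_lbound[OF ** *(2)] arccos_le_pi2[OF *] by blast
  have "cos (angle \<mu>) = sqrt (3 * ?A)"
    unfolding angle_def by (rule cos_arccos[OF ** *(2)])
  then show A: "?A = (cos (angle \<mu>))\<^sup>2 / 3" using AB by simp
  show "?B = (sin (angle \<mu>))\<^sup>2 / 3"
    using AB(3) unfolding A by (simp add: sin_squared_eq field_simps)
qed

section \<open>Transport costs of couplings and the Wasserstein distance\<close>

definition transport_cost :: "((real \<times> real) \<times> (real \<times> real)) measure \<Rightarrow> real" where
  "transport_cost \<gamma> = integral\<^sup>L \<gamma> (\<lambda>(p, q). (norm (p - q))\<^sup>2)"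

text \<open>The independent coupling shows below that the infimum defining
  \<open>wasserstein\<close> is over a nonempty set and hence finite.\<close>

lemma couplings_nonempty:
  assumes "\<mu> \<in> permutons" "\<nu> \<in> permutons"
  shows "\<mu> \<Otimes>\<^sub>M \<nu> \<in> couplings \<mu> \<nu>"
proof -
  interpret M: prob_space \<mu> by (rule permuton_prob_space) fact
  interpret N: prob_space \<nu> by (rule permuton_prob_space) fact
  interpret pair_prob_space \<mu> \<nu> ..
  note s = permuton_sets[OF assms(1)] permuton_sets[OF assms(2)]
  have "sets (\<mu> \<Otimes>\<^sub>M \<nu>) = sets borel"
    using sets_pair_measure_cong[OF s] by (simp only: borel_prod)
  moreover have "distr (\<mu> \<Otimes>\<^sub>M \<nu>) borel fst = \<mu>"
    using N.distr_pair_fst[of \<mu>] distr_cong[OF refl s(1), of "\<mu> \<Otimes>\<^sub>M \<nu>" fst fst] by simp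
  moreover have "distr (\<mu> \<Otimes>\<^sub>M \<nu>) borel snd = \<nu>"
  proof (rule measure_eqI)
    fix A assume "A \<in> sets (distr (\<mu> \<Otimes>\<^sub>M \<nu>) borel snd)"
    then have A: "A \<in> sets \<nu>" using s by simp
    have "snd \<in> \<mu> \<Otimes>\<^sub>M \<nu> \<rightarrow>\<^sub>M borel"
      using measurable_snd[of \<mu> \<nu>] measurable_cong_sets[OF refl s(2)] by blast
    then have "emeasure (distr (\<mu> \<Otimes>\<^sub>M \<nu>) borel snd) A = emeasure (\<mu> \<Otimes>\<^sub>M \<nu>) (space \<mu> \<times> A)"
      using A s sets.sets_into_space[OF A]
      by (subst emeasure_distr) (auto intro!: arg_cong[where f="emeasure (\<mu> \<Otimes>\<^sub>M \<nu>)"] simp: space_pair_measure)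
    also have "\<dots> = emeasure \<nu> A"
      using A by (simp add: N.emeasure_pair_measure_Times M.emeasure_space_1)
    finally show "emeasure (distr (\<mu> \<Otimes>\<^sub>M \<nu>) borel snd) A = emeasure \<nu> A" .
  qed (use s in simp)
  ultimately show ?thesis
    by (simp add: couplings_def prob_space_axioms)
qed

context
  fixes \<mu> \<nu> :: "(real \<times> real) measure" and \<gamma> :: "((real \<times> real) \<times> (real \<times> real)) measure"
  assumes \<mu>: "\<mu> \<in> permutons" and \<nu>: "\<nu> \<in> permutons" and \<gamma>: "\<gamma> \<in> couplings \<mu> \<nu>"
begin

lemma coupling_prob_space: "prob_space \<gamma>"
  using \<gamma> by (simp add: couplings_def)

lemma coupling_sets: "sets \<gamma> = sets borel"
  using \<gamma> by (simp add: couplings_def)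

lemma coupling_marginals: "distr \<gamma> borel fst = \<mu>" "distr \<gamma> borel snd = \<nu>"
  using \<gamma> by (simp_all add: couplings_def)

lemma coupling_integral:
  fixes f :: "real \<times> real \<Rightarrow> 'b :: {banach, second_countable_topology}"
  assumes [measurable]: "f \<in> borel_measurable borel"
  shows "integral\<^sup>L \<gamma> (\<lambda>z. f (fst z)) = integral\<^sup>L \<mu> f" "integral\<^sup>L \<gamma> (\<lambda>z. f (snd z)) = integral\<^sup>L \<nu> f"
proof -
  note [measurable_cong] = coupling_sets
  have "integral\<^sup>L (distr \<gamma> borel fst) f = integral\<^sup>L \<gamma> (\<lambda>z. f (fst z))"
    "integral\<^sup>L (distr \<gamma> borel snd) f = integral\<^sup>L \<gamma> (\<lambda>z. f (snd z))"
    by (auto intro!: integral_distr)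
  then show "integral\<^sup>L \<gamma> (\<lambda>z. f (fst z)) = integral\<^sup>L \<mu> f" "integral\<^sup>L \<gamma> (\<lambda>z. f (snd z)) = integral\<^sup>L \<nu> f"
    by (simp_all add: coupling_marginals)
qed

lemma coupling_AE:
  "AE z in \<gamma>. \<bar>diag (fst z)\<bar> \<le> 1 \<and> \<bar>anti (fst z)\<bar> \<le> 1 \<and> \<bar>diag (snd z)\<bar> \<le> 1 \<and> \<bar>anti (snd z)\<bar> \<le> 1"
proof -
  note [measurable_cong] = coupling_sets
  have "AE p in distr \<gamma> borel fst. \<bar>diag p\<bar> \<le> 1 \<and> \<bar>anti p\<bar> \<le> 1"
    "AE p in distr \<gamma> borel snd. \<bar>diag p\<bar> \<le> 1 \<and> \<bar>anti p\<bar> \<le> 1"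
    using permuton_AE_diag_anti \<mu> \<nu> by (simp_all add: coupling_marginals)
  then show ?thesis by (simp add: AE_distr_iff)
qed

lemma coupling_integrable:
  "integrable \<gamma> (\<lambda>z. (diag (fst z))\<^sup>2)" "integrable \<gamma> (\<lambda>z. (diag (snd z))\<^sup>2)" "integrable \<gamma> (\<lambda>z. diag (fst z) * diag (snd z))"
  "integrable \<gamma> (\<lambda>z. (anti (fst z))\<^sup>2)" "integrable \<gamma> (\<lambda>z. (anti (snd z))\<^sup>2)" "integrable \<gamma> (\<lambda>z. anti (fst z) * anti (snd z))"
proof -
  note [measurable_cong] = coupling_sets
  interpret prob_space \<gamma> by (rule coupling_prob_space)
  have "AE z in \<gamma>. (diag (fst z))\<^sup>2 \<le> 1 \<and> (diag (snd z))\<^sup>2 \<le> 1 \<and> \<bar>diag (fst z) * diag (snd z)\<bar> \<le> 1 \<and>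
     (anti (fst z))\<^sup>2 \<le> 1 \<and> (anti (snd z))\<^sup>2 \<le> 1 \<and> \<bar>anti (fst z) * anti (snd z)\<bar> \<le> 1"
    using coupling_AE by eventually_elim (auto simp: abs_square_le_1 abs_mult mult_le_one)
  then show "integrable \<gamma> (\<lambda>z. (diag (fst z))\<^sup>2)" "integrable \<gamma> (\<lambda>z. (diag (snd z))\<^sup>2)" "integrable \<gamma> (\<lambda>z. diag (fst z) * diag (snd z))"
    "integrable \<gamma> (\<lambda>z. (anti (fst z))\<^sup>2)" "integrable \<gamma> (\<lambda>z. (anti (snd z))\<^sup>2)" "integrable \<gamma> (\<lambda>z. anti (fst z) * anti (snd z))"
    by (auto intro!: integrable_const_bound[where B=1])
qed

lemma coupling_second_moments:
  "integral\<^sup>L \<gamma> (\<lambda>z. (diag (fst z))\<^sup>2) = (cos (angle \<mu>))\<^sup>2 / 3"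
  "integral\<^sup>L \<gamma> (\<lambda>z. (diag (snd z))\<^sup>2) = (cos (angle \<nu>))\<^sup>2 / 3"
  "integral\<^sup>L \<gamma> (\<lambda>z. (anti (fst z))\<^sup>2) = (sin (angle \<mu>))\<^sup>2 / 3"
  "integral\<^sup>L \<gamma> (\<lambda>z. (anti (snd z))\<^sup>2) = (sin (angle \<nu>))\<^sup>2 / 3"
  using coupling_integral[of "\<lambda>p. (diag p)\<^sup>2"] coupling_integral[of "\<lambda>p. (anti p)\<^sup>2"]
    permuton_angle[OF \<mu>] permuton_angle[OF \<nu>] by simp_all

lemma transport_cost_integrand:
  "(\<lambda>(p, q). (norm (p - q))\<^sup>2) = (\<lambda>z. 2 * ((diag (fst z))\<^sup>2 + (diag (snd z))\<^sup>2 + (anti (fst z))\<^sup>2 + (anti (snd z))\<^sup>2)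
     - 4 * (diag (fst z) * diag (snd z) + anti (fst z) * anti (snd z)))"
  unfolding norm_sq_diag_anti by (auto simp: power2_eq_square algebra_simps)

lemma transport_cost_integrable: "integrable \<gamma> (\<lambda>(p, q). (norm (p - q))\<^sup>2)"
  unfolding transport_cost_integrand using coupling_integrable by simp

text \<open>The marginals fix all pure second moments, which contribute
  \<open>2 * (1/3 + 1/3)\<close>. Only the two correlations depend on the coupling.\<close>

lemma transport_cost_eq:
  "transport_cost \<gamma> = 4 / 3 - 4 * (integral\<^sup>L \<gamma> (\<lambda>z. diag (fst z) * diag (snd z)) + integral\<^sup>L \<gamma> (\<lambda>z. anti (fst z) * anti (snd z)))"
proof -
  let ?a = "cos (angle \<mu>)" and ?a' = "cos (angle \<nu>)" and ?b = "sin (angle \<mu>)" and ?b' = "sin (angle \<nu>)"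
  have "transport_cost \<gamma> = 2 * (?a\<^sup>2 / 3 + ?a'\<^sup>2 / 3 + ?b\<^sup>2 / 3 + ?b'\<^sup>2 / 3)
     - 4 * (integral\<^sup>L \<gamma> (\<lambda>z. diag (fst z) * diag (snd z)) + integral\<^sup>L \<gamma> (\<lambda>z. anti (fst z) * anti (snd z)))"
    unfolding transport_cost_def transport_cost_integrand
    using coupling_integrable by (simp add: coupling_second_moments)
  then show ?thesis by (simp add: sin_squared_eq field_simps)
qed

text \<open>Cauchy-Schwarz, the norms being the cosine or sine of the angle over
  \<open>sqrt 3\<close>. Angles lie in the first quadrant, so the square roots of the squares are
  the cosines and sines themselves.\<close>

lemma coupling_correlation_le:
  "integral\<^sup>L \<gamma> (\<lambda>z. diag (fst z) * diag (snd z)) \<le> cos (angle \<mu>) * cos (angle \<nu>) / 3"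
  "integral\<^sup>L \<gamma> (\<lambda>z. anti (fst z) * anti (snd z)) \<le> sin (angle \<mu>) * sin (angle \<nu>) / 3"
proof -
  interpret prob_space \<gamma> by (rule coupling_prob_space)
  have nn: "0 \<le> cos (angle \<mu>)" "0 \<le> cos (angle \<nu>)" "0 \<le> sin (angle \<mu>)" "0 \<le> sin (angle \<nu>)"
    using permuton_angle(1)[OF \<mu>] permuton_angle(1)[OF \<nu>] by (auto intro!: cos_ge_zero sin_ge_zero)
  have "sqrt 3 * sqrt 3 = 3" by simp
  then show "integral\<^sup>L \<gamma> (\<lambda>z. diag (fst z) * diag (snd z)) \<le> cos (angle \<mu>) * cos (angle \<nu>) / 3"
    "integral\<^sup>L \<gamma> (\<lambda>z. anti (fst z) * anti (snd z)) \<le> sin (angle \<mu>) * sin (angle \<nu>) / 3"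
    using integral_Cauchy_Schwarz[OF coupling_integrable(1-3)] integral_Cauchy_Schwarz[OF coupling_integrable(4-6)] nn
    by (simp_all add: coupling_second_moments real_sqrt_divide)
qed

text \<open>The left side is twice the squared chord between the two angles on the circle of radius
  \<open>1 / sqrt 3\<close>, the factor 2 being that of \<open>norm_sq_diag_anti\<close>.\<close>

lemma transport_cost_ge: "4 / 3 * (1 - cos (angle \<nu> - angle \<mu>)) \<le> transport_cost \<gamma>"
  using coupling_correlation_le by (simp add: transport_cost_eq cos_diff algebra_simps)

lemma nn_integral_transport_cost:
  "(\<integral>\<^sup>+ (p, q). ennreal ((norm (p - q))\<^sup>2) \<partial>\<gamma>) = ennreal (transport_cost \<gamma>)"
  unfolding transport_cost_def
  using nn_integral_eq_integral[OF transport_cost_integrable] by (simp add: case_prod_beta')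

lemma transport_cost_nonneg: "0 \<le> transport_cost \<gamma>"
  unfolding transport_cost_def by (rule integral_nonneg_AE) auto

lemma wasserstein_le_transport_cost: "(wasserstein \<mu> \<nu>)\<^sup>2 \<le> transport_cost \<gamma>"
proof -
  have "(INF \<gamma> \<in> couplings \<mu> \<nu>. \<integral>\<^sup>+ (v, v'). ennreal ((norm (v - v'))\<^sup>2) \<partial>\<gamma>) \<le> ennreal (transport_cost \<gamma>)"
    using nn_integral_transport_cost \<gamma> by (metis (no_types, lifting) INF_lower)
  then have "enn2real (INF \<gamma> \<in> couplings \<mu> \<nu>. \<integral>\<^sup>+ (v, v'). ennreal ((norm (v - v'))\<^sup>2) \<partial>\<gamma>) \<le> transport_cost \<gamma>"
    using enn2real_mono[of _ "ennreal (transport_cost \<gamma>)"] transport_cost_nonneg by fastforce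
  then show ?thesis unfolding wasserstein_def by simp
qed

end

text \<open>Nearly optimal couplings take the place of optimal ones throughout; the slack
  \<open>\<epsilon>\<close> is chosen by each application.\<close>

lemma wasserstein_approx:
  assumes \<mu>: "\<mu> \<in> permutons" and \<nu>: "\<nu> \<in> permutons" and "0 < \<epsilon>"
  shows "\<exists>\<gamma>\<in>couplings \<mu> \<nu>. transport_cost \<gamma> < (wasserstein \<mu> \<nu>)\<^sup>2 + \<epsilon>"
proof -
  let ?I = "INF \<gamma> \<in> couplings \<mu> \<nu>. \<integral>\<^sup>+ (v, v'). ennreal ((norm (v - v'))\<^sup>2) \<partial>\<gamma>"
  have "?I \<le> ennreal (transport_cost (\<mu> \<Otimes>\<^sub>M \<nu>))"
    using nn_integral_transport_cost[OF \<mu> \<nu> couplings_nonempty[OF \<mu> \<nu>]] couplings_nonempty[OF \<mu> \<nu>]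
    by (metis (no_types, lifting) INF_lower)
  \<comment> \<open>\<open>enn2real\<close> sends infinity to 0, so finiteness is what lets
    \<open>wasserstein\<close> be read back as the infimum.\<close>
  then have fin: "?I < top" by (rule le_less_trans) simp
  have I: "?I = ennreal ((wasserstein \<mu> \<nu>)\<^sup>2)"
    unfolding wasserstein_def using ennreal_enn2real[OF fin] by (simp add: real_sqrt_pow2)
  have "?I < ennreal ((wasserstein \<mu> \<nu>)\<^sup>2 + \<epsilon>)"
    unfolding I using \<open>0 < \<epsilon>\<close> by (intro ennreal_lessI) (auto intro: add_nonneg_pos)
  then obtain \<gamma> where \<gamma>: "\<gamma> \<in> couplings \<mu> \<nu>"
    "(\<integral>\<^sup>+ (v, v'). ennreal ((norm (v - v'))\<^sup>2) \<partial>\<gamma>) < ennreal ((wasserstein \<mu> \<nu>)\<^sup>2 + \<epsilon>)"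
    by (auto simp: INF_less_iff)
  then have "ennreal (transport_cost \<gamma>) < ennreal ((wasserstein \<mu> \<nu>)\<^sup>2 + \<epsilon>)"
    by (simp add: nn_integral_transport_cost[OF \<mu> \<nu>])
  then have "transport_cost \<gamma> < (wasserstein \<mu> \<nu>)\<^sup>2 + \<epsilon>"
    using transport_cost_nonneg[OF \<mu> \<nu> \<gamma>(1)] by (simp add: ennreal_less_iff)
  with \<gamma>(1) show ?thesis by blast
qed

lemma wasserstein_ge_chord:
  assumes \<mu>: "\<mu> \<in> permutons" and \<nu>: "\<nu> \<in> permutons"
  shows "4 / 3 * (1 - cos (angle \<nu> - angle \<mu>)) \<le> (wasserstein \<mu> \<nu>)\<^sup>2"
proof (rule field_le_epsilon)
  fix \<epsilon> :: real assume "0 < \<epsilon>"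
  from wasserstein_approx[OF \<mu> \<nu> this] transport_cost_ge[OF \<mu> \<nu>]
  show "4 / 3 * (1 - cos (angle \<nu> - angle \<mu>)) \<le> (wasserstein \<mu> \<nu>)\<^sup>2 + \<epsilon>" by fastforce
qed

section \<open>Energy along partitions\<close>

definition is_partition :: "real \<Rightarrow> real \<Rightarrow> nat \<Rightarrow> (nat \<Rightarrow> real) \<Rightarrow> bool" where
  "is_partition u v k t \<longleftrightarrow> t 0 = u \<and> t k = v \<and> strict_mono_on {0..k} t"

definition partition_sum :: "(real \<Rightarrow> real \<Rightarrow> real) \<Rightarrow> nat \<Rightarrow> (nat \<Rightarrow> real) \<Rightarrow> real" where
  "partition_sum d k t = (\<Sum>i=1..k. d (t (i - 1)) (t i) / (t i - t (i - 1)))"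

text \<open>A lower bound witnessed by one finite partition. Such bounds on adjacent intervals add
  up by concatenation, so no suprema over subintervals have to be handled.\<close>

definition partition_sum_ge :: "(real \<Rightarrow> real \<Rightarrow> real) \<Rightarrow> real \<Rightarrow> real \<Rightarrow> real \<Rightarrow> bool" where
  "partition_sum_ge d u v c \<longleftrightarrow> (\<exists>k t. is_partition u v k t \<and> c \<le> partition_sum d k t)"

lemma partition_sum_ge_mono: "partition_sum_ge d u v c \<Longrightarrow> b \<le> c \<Longrightarrow> partition_sum_ge d u v b"
  unfolding partition_sum_ge_def using order_trans by blast

lemma partition_sum_ge_empty: "partition_sum_ge d u u 0"
  unfolding partition_sum_ge_def
  by (intro exI[of _ 0] exI[of _ "\<lambda>_. u"]) (auto simp: is_partition_def partition_sum_def strict_mono_on_def)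

lemma partition_sum_ge_single:
  assumes "u < v"
  shows "partition_sum_ge d u v (d u v / (v - u))"
  unfolding partition_sum_ge_def using assms
  by (intro exI[of _ 1] exI[of _ "\<lambda>i. if i = 0 then u else v"])
     (auto simp: is_partition_def partition_sum_def strict_mono_on_def)

lemma partition_sum_ge_concat:
  assumes "partition_sum_ge d u v b" "partition_sum_ge d v w c"
  shows "partition_sum_ge d u w (b + c)"
proof -
  obtain k t where "is_partition u v k t" and b: "b \<le> partition_sum d k t"
    using assms(1) unfolding partition_sum_ge_def by blast
  then have t: "t 0 = u" "t k = v" "strict_mono_on {0..k} t" by (auto simp: is_partition_def)
  obtain l s where "is_partition v w l s" and c: "c \<le> partition_sum d l s"
    using assms(2) unfolding partition_sum_ge_def by blast
  then have s: "s 0 = v" "s l = w" "strict_mono_on {0..l} s" by (auto simp: is_partition_def)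
  \<comment> \<open>At the junction both pieces have the value \<open>v\<close>, so
    \<open>r (i + k) = s i\<close> holds for \<open>i = 0\<close> too.\<close>
  define r where "r i = (if i \<le> k then t i else s (i - k))" for i
  have rs: "r (i + k) = s i" for i using t s by (cases "i = 0") (auto simp: r_def)
  let ?g = "\<lambda>r i. d (r (i - 1)) (r i) / (r i - r (i - 1)) :: real"
  have "strict_mono_on {0..k + l} r"
  proof (rule strict_mono_onI)
    fix i j assume ij: "i \<in> {0..k + l}" "j \<in> {0..k + l}" "i < j"
    have si: "s i < s j" if "i < j" "j \<le> l" for i j using that s(3)
      by (auto simp: strict_mono_on_def)
    consider "j \<le> k" | "i \<le> k" "k < j" | "k < i" by linarith
    then show "r i < r j"
    proof cases
      case 1
      then show ?thesis using ij t(3) by (auto simp: r_def strict_mono_on_def)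
    next
      case 2
      have "t i \<le> v"
        using 2 t(2,3) by (cases "i = k") (auto simp: strict_mono_on_def less_imp_le)
      also have "v < s (j - k)" using si[of 0 "j - k"] 2 ij s(1) by auto
      finally show ?thesis using 2 by (simp add: r_def)
    next
      case 3
      then show ?thesis using ij si[of "i - k" "j - k"] by (auto simp: r_def)
    qed
  qed
  moreover have "partition_sum d (k + l) r = partition_sum d k t + partition_sum d l s"
  proof -
    have "(\<Sum>i=1..k + l. ?g r i) = (\<Sum>i=1..k. ?g r i) + (\<Sum>i=1 + k..l + k. ?g r i)"
      by (subst sum.ub_add_nat) (auto simp: add.commute)
    also have "(\<Sum>i=1 + k..l + k. ?g r i) = (\<Sum>i=1..l. ?g r (i + k))"
      by (rule sum.shift_bounds_cl_nat_ivl)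
    also have "\<dots> = (\<Sum>i=1..l. ?g s i)"
    proof (rule sum.cong[OF refl])
      fix i assume "i \<in> {1..l}"
      \<comment> \<open>Truncated subtraction commutes with the shift because \<open>i\<close> is at
        least 1.\<close>
      then have "i + k - 1 = (i - 1) + k" by auto
      then show "?g r (i + k) = ?g s i" by (simp only: rs)
    qed
    also have "(\<Sum>i=1..k. ?g r i) = (\<Sum>i=1..k. ?g t i)"
      by (intro sum.cong) (auto simp: r_def)
    finally show ?thesis by (simp only: partition_sum_def)
  qed
  ultimately show ?thesis
    unfolding partition_sum_ge_def using t s rs[of l] b c
    by (intro exI[of _ "k + l"] exI[of _ r]) (auto simp: is_partition_def r_def add.commute)
qed

text \<open>The later time comes first inside \<open>wasserstein\<close>, as in
  \<open>energy\<close>.\<close>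

abbreviation wasserstein_sq :: "(real \<Rightarrow> (real \<times> real) measure) \<Rightarrow> real \<Rightarrow> real \<Rightarrow> real" where
  "wasserstein_sq \<mu> \<equiv> (\<lambda>s t. (wasserstein (\<mu> t) (\<mu> s))\<^sup>2)"

lemma partition_sum_le_energy:
  assumes "partition_sum_ge (wasserstein_sq \<mu>) 0 1 c"
  shows "ennreal c \<le> energy \<mu>"
proof -
  obtain k t where t: "is_partition 0 1 k t" and c: "c \<le> partition_sum (wasserstein_sq \<mu>) k t"
    using assms unfolding partition_sum_ge_def by blast
  have "ennreal c \<le> ennreal (\<Sum>i=1..k. (wasserstein (\<mu> (t i)) (\<mu> (t (i - 1))))\<^sup>2 / (t i - t (i - 1)))"
    using c by (simp add: partition_sum_def ennreal_leI)
  also have "\<dots> \<le> energy \<mu>"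
    unfolding energy_def using t by (intro SUP_upper2[of "(k, t)"]) (auto simp: partitions_def is_partition_def)
  finally show ?thesis .
qed

section \<open>Chords of the quarter circle and the lower bound for the energy\<close>

lemma convex_on_one_minus_cos: "convex_on {- (pi / 2)..pi / 2} (\<lambda>x. 1 - cos x)"
  by (rule f''_ge0_imp_convex[where f'=sin and f''=cos])
     (auto intro!: derivative_eq_intros cos_ge_zero)

text \<open>By convexity of \<^term>\<open>\<lambda>x. 1 - cos x\<close>, among all subdivisions of an arc of a circle into
  \<open>n\<close> pieces the equidistant one minimises the sum of the squared chords.\<close>

lemma partition_sum_ge_chords:
  fixes \<theta> :: "real \<Rightarrow> real"
  assumes "u < v" "0 < n"
    and \<theta>: "\<And>t. t \<in> {u..v} \<Longrightarrow> \<theta> t \<in> {0..pi / 2}"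
    and d: "\<And>s t. s \<in> {u..v} \<Longrightarrow> t \<in> {u..v} \<Longrightarrow> 4 / 3 * (1 - cos (\<theta> t - \<theta> s)) \<le> d s t"
  shows "partition_sum_ge d u v (4 / 3 * ((real n)\<^sup>2 * (1 - cos ((\<theta> v - \<theta> u) / real n))) / (v - u))"
proof -
  define t where "t i = u + real i * ((v - u) / real n)" for i
  have h: "0 < (v - u) / real n" using assms by simp
  have tn: "t 0 = u" "t n = v" using \<open>0 < n\<close> by (auto simp: t_def)
  have mono: "t i < t j" if "i < j" for i j
    unfolding t_def using that by (intro add_strict_left_mono mult_strict_right_mono h) simp
  have range: "t i \<in> {u..v}" if "i \<le> n" for i
    using that mono[of 0 i] mono[of i n] tn by (cases "i = 0"; cases "i = n") auto
  have diff: "t i - t (i - 1) = (v - u) / real n" if "1 \<le> i" for i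
    using that by (simp add: t_def of_nat_diff algebra_simps diff_divide_distrib)
  \<comment> \<open>Jensen's inequality with equal weights \<open>1 / n\<close>; the angle
    increments telescope to the total increment.\<close>
  have "1 - cos (\<Sum>i\<in>{1..n}. (1 / real n) *\<^sub>R (\<theta> (t i) - \<theta> (t (i - 1))))
      \<le> (\<Sum>i\<in>{1..n}. (1 / real n) * (1 - cos (\<theta> (t i) - \<theta> (t (i - 1)))))"
  proof (rule convex_on_sum[OF _ _ convex_on_one_minus_cos])
    fix i assume "i \<in> {1..n}"
    then have "i \<le> n" "i - 1 \<le> n" by auto
    from this[THEN range, THEN \<theta>] show "\<theta> (t i) - \<theta> (t (i - 1)) \<in> {- (pi / 2)..pi / 2}" by auto
  qed (use \<open>0 < n\<close> in auto)
  also have "(\<Sum>i\<in>{1..n}. (1 / real n) *\<^sub>R (\<theta> (t i) - \<theta> (t (i - 1)))) = (\<theta> v - \<theta> u) / real n"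
    using sum_telescope''[of 0 n "\<lambda>i. \<theta> (t i)"] tn
    by (simp flip: sum_distrib_left sum_divide_distrib)
  also have "(\<Sum>i\<in>{1..n}. (1 / real n) * (1 - cos (\<theta> (t i) - \<theta> (t (i - 1)))))
      = (\<Sum>i=1..n. 1 - cos (\<theta> (t i) - \<theta> (t (i - 1)))) / real n"
    by (simp add: sum_divide_distrib)
  finally have "(real n)\<^sup>2 * (1 - cos ((\<theta> v - \<theta> u) / real n))
      \<le> (real n)\<^sup>2 * ((\<Sum>i=1..n. 1 - cos (\<theta> (t i) - \<theta> (t (i - 1)))) / real n)"
    by (rule mult_left_mono) simp
  also have "\<dots> = real n * (\<Sum>i=1..n. 1 - cos (\<theta> (t i) - \<theta> (t (i - 1))))"
    using \<open>0 < n\<close> by (simp add: power2_eq_square)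
  finally have "4 / 3 * ((real n)\<^sup>2 * (1 - cos ((\<theta> v - \<theta> u) / real n))) / (v - u)
      \<le> 4 / 3 * (real n * (\<Sum>i=1..n. 1 - cos (\<theta> (t i) - \<theta> (t (i - 1))))) / (v - u)"
    using \<open>u < v\<close> by (intro divide_right_mono mult_left_mono) auto
  also have "\<dots> = (\<Sum>i=1..n. 4 / 3 * (1 - cos (\<theta> (t i) - \<theta> (t (i - 1)))) / ((v - u) / real n))"
    by (simp add: sum_distrib_left sum_distrib_right sum_divide_distrib mult_ac)
  also have "\<dots> \<le> (\<Sum>i=1..n. d (t (i - 1)) (t i) / (t i - t (i - 1)))"
  proof (rule sum_mono)
    fix i assume i: "i \<in> {1..n}"
    then have "4 / 3 * (1 - cos (\<theta> (t i) - \<theta> (t (i - 1)))) \<le> d (t (i - 1)) (t i)"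
      by (intro d range) auto
    then show "4 / 3 * (1 - cos (\<theta> (t i) - \<theta> (t (i - 1)))) / ((v - u) / real n)
        \<le> d (t (i - 1)) (t i) / (t i - t (i - 1))"
      using i h by (simp only: diff atLeastAtMost_iff) (intro divide_right_mono, auto)
  qed
  finally show ?thesis
    unfolding partition_sum_ge_def using tn mono
    by (intro exI[of _ n] exI[of _ t]) (auto simp: is_partition_def partition_sum_def strict_mono_on_def)
qed

lemma tendsto_sq_times_one_minus_cos:
  "(\<lambda>n. (real n)\<^sup>2 * (1 - cos (x / real n))) \<longlonglongrightarrow> x\<^sup>2 / 2"
proof -
  \<comment> \<open>The asymptotic expansion is computed for positive \<open>x\<close>; evenness of
    cosine covers the negative case.\<close>
  have pos: "(\<lambda>n. (real n)\<^sup>2 * (1 - cos (x / real n))) \<longlonglongrightarrow> x\<^sup>2 / 2" if "0 < x" for x :: real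
  proof -
    have "(\<lambda>n. (real n)\<^sup>2 * (1 - cos (x / real n))) \<longlonglongrightarrow> x * x / 2"
      using that by real_asymp
    then show ?thesis by (simp add: power2_eq_square)
  qed
  consider "x = 0" | "0 < x" | "0 < - x" by linarith
  then show ?thesis
    by cases (use pos[of x] pos[of "- x"] in auto)
qed

text \<open>As \<open>n\<close> grows, the chord bound tends to the energy of traversing the arc at
  constant speed. A value strictly below this limit is already exceeded for some finite
  \<open>n\<close>.\<close>

lemma partition_sum_ge_arc:
  fixes \<theta> :: "real \<Rightarrow> real"
  assumes "u < v"
    and \<theta>: "\<And>t. t \<in> {u..v} \<Longrightarrow> \<theta> t \<in> {0..pi / 2}"
    and d: "\<And>s t. s \<in> {u..v} \<Longrightarrow> t \<in> {u..v} \<Longrightarrow> 4 / 3 * (1 - cos (\<theta> t - \<theta> s)) \<le> d s t"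
    and c: "c < 2 / 3 * (\<theta> v - \<theta> u)\<^sup>2 / (v - u)"
  shows "partition_sum_ge d u v c"
proof -
  let ?f = "\<lambda>n. 4 / 3 * ((real n)\<^sup>2 * (1 - cos ((\<theta> v - \<theta> u) / real n))) / (v - u)"
  have "?f \<longlonglongrightarrow> 4 / 3 * ((\<theta> v - \<theta> u)\<^sup>2 / 2) / (v - u)"
    by (intro tendsto_intros tendsto_sq_times_one_minus_cos) (use \<open>u < v\<close> in auto)
  moreover have "c < 4 / 3 * ((\<theta> v - \<theta> u)\<^sup>2 / 2) / (v - u)" using c by simp
  ultimately have "eventually (\<lambda>n. c < ?f n) sequentially" by (rule order_tendstoD)
  then have "eventually (\<lambda>n. 0 < n \<and> c < ?f n) sequentially"
    using eventually_gt_at_top by eventually_elim auto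
  then obtain n where n: "0 < n" "c < ?f n"
    using eventually_happens'[OF sequentially_bot] by blast
  have "partition_sum_ge d u v (?f n)"
    using n(1) by (intro partition_sum_ge_chords assms)
  then show ?thesis
    using n(2) by (rule partition_sum_ge_mono[OF _ less_imp_le])
qed

context
  fixes \<mu> :: "real \<Rightarrow> (real \<times> real) measure"
  assumes permuton: "\<forall>t\<in>{0..1}. \<mu> t \<in> permutons"
begin

lemma path_partition_sum_ge:
  assumes "0 \<le> u" "u < v" "v \<le> 1" "c < 2 / 3 * (angle (\<mu> v) - angle (\<mu> u))\<^sup>2 / (v - u)"
  shows "partition_sum_ge (wasserstein_sq \<mu>) u v c"
proof (rule partition_sum_ge_arc[where \<theta>="\<lambda>t. angle (\<mu> t)", OF \<open>u < v\<close> _ _ assms(4)])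
  fix t assume "t \<in> {u..v}"
  then show "angle (\<mu> t) \<in> {0..pi / 2}" using assms by (intro permuton_angle permuton[rule_format]) auto
next
  fix s t assume "s \<in> {u..v}" "t \<in> {u..v}"
  then have "4 / 3 * (1 - cos (angle (\<mu> s) - angle (\<mu> t))) \<le> (wasserstein (\<mu> t) (\<mu> s))\<^sup>2"
    using assms by (intro wasserstein_ge_chord permuton[rule_format]) auto
  then show "4 / 3 * (1 - cos (angle (\<mu> t) - angle (\<mu> s))) \<le> (wasserstein (\<mu> t) (\<mu> s))\<^sup>2"
    using cos_minus[of "angle (\<mu> s) - angle (\<mu> t)"] by simp
qed

text \<open>A smaller energy would be finite, and partitions reach every real number strictly
  between it and the bound. For angles 0 and \<open>pi / 2\<close> the bound is
  \<open>pi\<^sup>2 / 6\<close>.\<close>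

lemma energy_ge_angle:
  "ennreal (2 / 3 * (angle (\<mu> 1) - angle (\<mu> 0))\<^sup>2) \<le> energy \<mu>"
proof (rule ccontr)
  let ?x = "2 / 3 * (angle (\<mu> 1) - angle (\<mu> 0))\<^sup>2"
  assume "\<not> ennreal ?x \<le> energy \<mu>"
  then have less: "energy \<mu> < ennreal ?x" by simp
  then obtain e where e: "energy \<mu> = ennreal e" "0 \<le> e"
    by (metis ennreal_cases ennreal_less_top not_less_iff_gr_or_eq order_less_trans top.not_eq_extremum)
  then have "e < ?x" using less by (simp add: ennreal_less_iff)
  then obtain c where c: "e < c" "c < ?x" using dense by blast
  have "ennreal c \<le> energy \<mu>"
    using c by (intro partition_sum_le_energy path_partition_sum_ge) auto
  then show False using e c by (simp add: ennreal_le_iff)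
qed

end

section \<open>Angles and increments of an energy minimiser\<close>

lemma energy_minimiser_step:
  assumes permuton: "\<forall>t\<in>{0..1}. \<mu> t \<in> permutons"
    and E: "energy \<mu> \<le> ennreal e"
    and \<theta>: "angle (\<mu> 0) = 0" "angle (\<mu> 1) = pi / 2"
    and st: "0 < s" "s \<le> t" "t < 1"
  shows "2 / 3 * (angle (\<mu> s))\<^sup>2 / s + (wasserstein (\<mu> t) (\<mu> s))\<^sup>2 / (t - s) + 2 / 3 * (pi / 2 - angle (\<mu> t))\<^sup>2 / (1 - t) \<le> e"
    (is "?a + ?b + ?c \<le> e")
proof (rule field_le_epsilon)
  fix \<epsilon> :: real assume "0 < \<epsilon>"
  \<comment> \<open>\<open>ennreal\<close> truncates negative numbers to 0, so the sign of
    \<open>e\<close> has to come from the positive lower bound for the energy.\<close>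
  have e: "0 \<le> e"
  proof (rule ccontr)
    assume "\<not> 0 \<le> e"
    then have "energy \<mu> \<le> 0" using E by (simp add: ennreal_neg)
    moreover have "0 < ennreal (2 / 3 * (angle (\<mu> 1) - angle (\<mu> 0))\<^sup>2)"
      by (simp add: \<theta>)
    ultimately show False using energy_ge_angle[OF permuton] by (simp only: le_zero_eq)
  qed
  \<comment> \<open>Three partitions are concatenated: fine ones of \<open>[0, s]\<close> and
    \<open>[t, 1]\<close>, each giving away half of \<open>\<epsilon>\<close>, and the single step
    from \<open>s\<close> to \<open>t\<close>.\<close>
  have "partition_sum_ge (wasserstein_sq \<mu>) 0 s (?a - \<epsilon> / 2)"
    by (rule path_partition_sum_ge[OF permuton]) (use st \<open>0 < \<epsilon>\<close> in \<open>simp_all add: \<theta>\<close>)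
  moreover have "partition_sum_ge (wasserstein_sq \<mu>) s t ?b"
  \<comment> \<open>For \<open>s = t\<close> the quotient \<open>?b\<close> is a division by zero,
    hence 0, in accordance with the empty partition.\<close>
  proof (cases "s = t")
    case True
    then show ?thesis by (simp add: partition_sum_ge_empty)
  next
    case False
    then show ?thesis using st(2) by (intro partition_sum_ge_single) simp
  qed
  moreover have "partition_sum_ge (wasserstein_sq \<mu>) t 1 (?c - \<epsilon> / 2)"
    by (rule path_partition_sum_ge[OF permuton]) (use st \<open>0 < \<epsilon>\<close> in \<open>simp_all add: \<theta>\<close>)
  ultimately have "partition_sum_ge (wasserstein_sq \<mu>) 0 1 ((?a - \<epsilon> / 2 + ?b) + (?c - \<epsilon> / 2))"
    by (intro partition_sum_ge_concat)
  then have "ennreal ((?a - \<epsilon> / 2 + ?b) + (?c - \<epsilon> / 2)) \<le> ennreal e"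
    using E by (blast intro: partition_sum_le_energy order_trans)
  then have "(?a - \<epsilon> / 2 + ?b) + (?c - \<epsilon> / 2) \<le> e"
    using e by (simp only: ennreal_le_iff)
  then show "?a + ?b + ?c \<le> e + \<epsilon>" by argo
qed

text \<open>Taking \<open>t = s\<close> in \<open>energy_minimiser_step\<close> leaves two constant
  speed arcs through the angle at time \<open>s\<close>. Their total exceeds that of the direct arc
  by a positive multiple of \<open>(x - w * s)\<^sup>2\<close>, so the angle must lie on the linear
  interpolation.\<close>

lemma energy_minimiser_angle:
  assumes permuton: "\<forall>t\<in>{0..1}. \<mu> t \<in> permutons"
    and E: "energy \<mu> \<le> ennreal (pi\<^sup>2 / 6)"
    and \<theta>: "angle (\<mu> 0) = 0" "angle (\<mu> 1) = pi / 2"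
    and s: "0 < s" "s < 1"
  shows "angle (\<mu> s) = pi / 2 * s"
proof -
  have sq: "(x - w * s)\<^sup>2 \<le> 0" if "2 / 3 * x\<^sup>2 / s + 2 / 3 * (w - x)\<^sup>2 / (1 - s) \<le> 2 / 3 * w\<^sup>2" for x w :: real
  proof -
    define X Y where "X = x\<^sup>2 / s" and "Y = (w - x)\<^sup>2 / (1 - s)"
    have "2 / 3 * x\<^sup>2 / s = 2 / 3 * X" "2 / 3 * (w - x)\<^sup>2 / (1 - s) = 2 / 3 * Y"
      by (simp_all only: X_def Y_def times_divide_eq_right)
    then have "X + Y \<le> w\<^sup>2" using that by linarith
    moreover have "x\<^sup>2 = s * X" "(w - x)\<^sup>2 = (1 - s) * Y"
      using s by (simp_all add: X_def Y_def)
    ultimately have XY: "x\<^sup>2 = s * X" "(w - x)\<^sup>2 = (1 - s) * Y" "X + Y \<le> w\<^sup>2"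
      by blast+
    have "(x - w * s)\<^sup>2 = (1 - s) * x\<^sup>2 + s * (w - x)\<^sup>2 - s * (1 - s) * w\<^sup>2"
      by (simp add: power2_eq_square algebra_simps)
    also have "\<dots> = s * (1 - s) * (X + Y - w\<^sup>2)"
      unfolding XY by (simp add: algebra_simps)
    also have "\<dots> \<le> 0"
      using s XY(3) by (intro mult_nonneg_nonpos) auto
    finally show ?thesis .
  qed
  have "2 / 3 * (angle (\<mu> s))\<^sup>2 / s + 2 / 3 * (pi / 2 - angle (\<mu> s))\<^sup>2 / (1 - s) \<le> 2 / 3 * (pi / 2)\<^sup>2"
    using energy_minimiser_step[OF permuton E \<theta> s(1) order_refl s(2)] by (simp add: power_divide)
  then have "(angle (\<mu> s) - pi / 2 * s)\<^sup>2 \<le> 0" by (rule sq)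
  then show ?thesis by simp
qed

text \<open>The outer arcs consume \<open>pi\<^sup>2 / 6\<close> times \<open>s\<close> and
  \<open>1 - t\<close>, so only \<open>pi\<^sup>2 / 6 * (t - s)\<close> remains for the step in the
  middle.\<close>

lemma energy_minimiser_wasserstein:
  assumes permuton: "\<forall>t\<in>{0..1}. \<mu> t \<in> permutons"
    and E: "energy \<mu> \<le> ennreal (pi\<^sup>2 / 6)"
    and \<theta>: "angle (\<mu> 0) = 0" "angle (\<mu> 1) = pi / 2"
    and st: "0 < s" "s < t" "t < 1"
  shows "(wasserstein (\<mu> t) (\<mu> s))\<^sup>2 \<le> pi\<^sup>2 / 6 * (t - s)\<^sup>2"
proof -
  have a: "angle (\<mu> r) = pi / 2 * r" if "r \<in> {0<..<1}" for r
    by (rule energy_minimiser_angle[OF permuton E \<theta>]) (use that in auto)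
  have "angle (\<mu> s) = pi / 2 * s" "angle (\<mu> t) = pi / 2 * t"
    using a[of s] a[of t] st by auto
  note a = this
  have sq: "2 / 3 * (pi / 2 * r)\<^sup>2 / r = pi\<^sup>2 / 6 * r" for r :: real
    by (simp add: power2_eq_square)
  have "pi / 2 - pi / 2 * t = pi / 2 * (1 - t)" by (simp add: algebra_simps)
  then have "2 / 3 * (pi / 2 - pi / 2 * t)\<^sup>2 / (1 - t) = pi\<^sup>2 / 6 * (1 - t)"
    by (simp only: sq)
  with sq[of s] have "(wasserstein (\<mu> t) (\<mu> s))\<^sup>2 / (t - s) \<le> pi\<^sup>2 / 6 - pi\<^sup>2 / 6 * s - pi\<^sup>2 / 6 * (1 - t)"
    using energy_minimiser_step[OF permuton E \<theta> st(1) less_imp_le[OF st(2)] st(3)] unfolding a by linarith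
  also have "p - p * s - p * (1 - t) = p * (t - s)" for p
    by (simp add: algebra_simps)
  finally have "(wasserstein (\<mu> t) (\<mu> s))\<^sup>2 \<le> pi\<^sup>2 / 6 * (t - s) * (t - s)"
    using st by (simp only: pos_divide_le_eq diff_gt_0_iff_gt)
  then show ?thesis by (simp add: power2_eq_square mult.assoc)
qed

section \<open>The Archimedean path\<close>

lemma iexp_Lipschitz: "cmod (iexp x - iexp y) \<le> \<bar>x - y\<bar>"
proof -
  have "iexp x = iexp y * iexp (x - y)"
    by (simp flip: exp_add add: right_diff_distrib)
  then have "iexp x - iexp y = iexp y * (iexp (x - y) - 1)"
    by (simp only: right_diff_distrib mult_1_right)
  then have "cmod (iexp x - iexp y) = cmod (iexp (x - y) - 1)"
    by (simp only: norm_mult norm_exp_i_times mult_1_left)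
  also have "\<dots> \<le> \<bar>x - y\<bar>"
    using iexp_approx1[of "x - y" 0] by simp
  finally show ?thesis .
qed

definition rot :: "real \<Rightarrow> real \<times> real \<Rightarrow> real \<times> real" where
  "rot \<phi> p = (cos \<phi> * fst p - sin \<phi> * snd p, sin \<phi> * fst p + cos \<phi> * snd p)"

lemma measurable_rot [measurable]: "rot \<phi> \<in> borel \<rightarrow>\<^sub>M borel"
  unfolding rot_def[abs_def] by (intro borel_measurable_continuous_onI continuous_intros)

lemma inner_rot: "rot \<phi> p \<bullet> u = p \<bullet> rot (- \<phi>) u"
  by (cases p, cases u) (simp add: rot_def algebra_simps)

lemma norm_rot: "norm (rot \<phi> u) = norm u"
proof -
  have "(c * a - s * b)\<^sup>2 + (s * a + c * b)\<^sup>2 = (s\<^sup>2 + c\<^sup>2) * (a\<^sup>2 + b\<^sup>2)" for a b c s :: real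
    by (simp add: power2_eq_square algebra_simps)
  from this[of "cos \<phi>" _ "sin \<phi>"] show ?thesis by (cases u) (simp add: rot_def norm_Pair)
qed

text \<open>A rotation of the measure can be moved to the unit vector projected on; uniqueness then
  gives invariance.\<close>

lemma uniform_projections_rot:
  assumes M: "uniform_projections M"
  shows "distr M borel (rot \<phi>) = M"
proof (rule uniform_projections_unique[OF _ M])
  have [measurable_cong]: "sets M = sets borel" using M by (simp add: uniform_projections_def)
  have "distr (distr M borel (rot \<phi>)) borel (\<lambda>p. p \<bullet> u) = unif" if "norm u = 1" for u
  proof -
    have "distr (distr M borel (rot \<phi>)) borel (\<lambda>p. p \<bullet> u) = distr M borel ((\<lambda>p. p \<bullet> u) \<circ> rot \<phi>)"
      by (rule distr_distr) auto
    also have "(\<lambda>p. p \<bullet> u) \<circ> rot \<phi> = (\<lambda>p. p \<bullet> rot (- \<phi>) u)"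
      by (auto simp: inner_rot)
    also have "distr M borel \<dots> = unif"
      using M that norm_rot[of "- \<phi>" u] unfolding uniform_projections_def by metis
    finally show ?thesis .
  qed
  then show "uniform_projections (distr M borel (rot \<phi>))"
    using M by (auto simp: uniform_projections_def intro!: prob_space.prob_space_distr)
qed

definition rotating_pair :: "real \<Rightarrow> real \<times> real \<Rightarrow> real \<times> real" where
  "rotating_pair t p = (cos (pi / 2 * t) * fst p - sin (pi / 2 * t) * snd p,
                        cos (pi / 2 * t) * fst p + sin (pi / 2 * t) * snd p)"

lemma measurable_rotating_pair [measurable]: "rotating_pair t \<in> borel \<rightarrow>\<^sub>M borel"
  unfolding rotating_pair_def[abs_def] by (intro borel_measurable_continuous_onI continuous_intros)

lemma diag_anti_rotating_pair:
  "diag (rotating_pair t p) = cos (pi / 2 * t) * fst p" "anti (rotating_pair t p) = sin (pi / 2 * t) * snd p"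
  by (simp_all add: rotating_pair_def diag_def anti_def)

lemma sets_archimedean [measurable_cong]: "sets archimedean_measure = sets borel"
  using uniform_projections_archimedean by (simp add: uniform_projections_def)

lemma prob_space_archimedean: "prob_space archimedean_measure"
  using uniform_projections_archimedean by (simp add: uniform_projections_def)

lemma archimedean_projection:
  "distr archimedean_measure borel (\<lambda>p. cos \<phi> * fst p + sin \<phi> * snd p) = unif"
proof -
  have "norm (cos \<phi>, sin \<phi>) = 1" by (simp add: norm_Pair)
  then have "distr archimedean_measure borel (\<lambda>p. p \<bullet> (cos \<phi>, sin \<phi>)) = unif"
    using uniform_projections_archimedean by (simp add: uniform_projections_def)
  then show ?thesis by (simp add: inner_prod_def mult.commute)
qed

text \<open>The Archimedean path in a frame rotated by half of the angle: there every point moves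
  symmetrically in both coordinates.\<close>

lemma archimedean_path_eq:
  "archimedean_path t = distr archimedean_measure borel (rotating_pair t)"
proof -
  let ?A = archimedean_measure and ?\<phi> = "pi / 2 * t"
  define h where "h = (\<lambda>p. (archimedean_process 0 p, archimedean_process t p))"
  have h: "h \<in> borel \<rightarrow>\<^sub>M borel"
    unfolding h_def archimedean_process_def case_prod_beta'
    by (intro borel_measurable_continuous_onI continuous_intros)
  have "archimedean_path t = distr (distr ?A borel (rot ?\<phi>)) borel h"
    unfolding uniform_projections_rot[OF uniform_projections_archimedean] archimedean_path_def h_def ..
  also have "\<dots> = distr ?A borel (h \<circ> rot ?\<phi>)"
    using h by (intro distr_distr) auto
  also have "h \<circ> rot ?\<phi> = rotating_pair t"
  proof
    fix p :: "real \<times> real"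
    have "cos (pi * t) = cos (?\<phi> + ?\<phi>)" "sin (pi * t) = sin (?\<phi> + ?\<phi>)" by simp_all
    then have c: "cos (pi * t) = cos ?\<phi> * cos ?\<phi> - sin ?\<phi> * sin ?\<phi>" "sin (pi * t) = 2 * sin ?\<phi> * cos ?\<phi>"
      unfolding cos_add sin_add by simp_all
    \<comment> \<open>Turning by \<open>?\<phi>\<close> and then projecting at angle
      \<open>2 * ?\<phi>\<close> is projecting at angle \<open>?\<phi>\<close>; this is the algebra
      behind it.\<close>
    have "(c * c - s * s) * (c * x - s * y) + 2 * s * c * (s * x + c * y) = (c * c + s * s) * (c * x + s * y)"
      for c s x y :: real
      by (simp add: algebra_simps)
    from this[of "cos ?\<phi>" "sin ?\<phi>" "fst p" "snd p"]
    have "cos (pi * t) * (cos ?\<phi> * fst p - sin ?\<phi> * snd p) + sin (pi * t) * (sin ?\<phi> * fst p + cos ?\<phi> * snd p)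
      = cos ?\<phi> * fst p + sin ?\<phi> * snd p"
      unfolding c by (simp only: sin_cos_squared_add3 mult_1_left)
    then show "(h \<circ> rot ?\<phi>) p = rotating_pair t p"
      by (simp add: h_def rot_def rotating_pair_def archimedean_process_def)
  qed
  finally show ?thesis .
qed

text \<open>Both marginals are projections of the Archimedean measure, in the directions of angle
  \<open>- pi / 2 * t\<close> and \<open>pi / 2 * t\<close>.\<close>

lemma archimedean_path_permuton: "archimedean_path t \<in> permutons"
proof -
  let ?A = archimedean_measure and ?\<phi> = "pi / 2 * t"
  interpret A: prob_space ?A by (rule prob_space_archimedean)
  have P: "prob_space (archimedean_path t)"
    unfolding archimedean_path_eq by (rule A.prob_space_distr) auto
  interpret P: prob_space "archimedean_path t" by (rule P)
  have S [measurable_cong]: "sets (archimedean_path t) = sets borel"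
    by (simp add: archimedean_path_eq)
  have "distr (archimedean_path t) borel fst = distr ?A borel (fst \<circ> rotating_pair t)"
    unfolding archimedean_path_eq by (rule distr_distr) auto
  also have "fst \<circ> rotating_pair t = (\<lambda>p. cos (- ?\<phi>) * fst p + sin (- ?\<phi>) * snd p)"
    by (auto simp: rotating_pair_def)
  also have "distr ?A borel \<dots> = unif" by (rule archimedean_projection)
  finally have F: "distr (archimedean_path t) borel fst = unif" .
  have "distr (archimedean_path t) borel snd = distr ?A borel (snd \<circ> rotating_pair t)"
    unfolding archimedean_path_eq by (rule distr_distr) auto
  also have "snd \<circ> rotating_pair t = (\<lambda>p. cos ?\<phi> * fst p + sin ?\<phi> * snd p)"
    by (auto simp: rotating_pair_def)
  also have "distr ?A borel \<dots> = unif" by (rule archimedean_projection)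
  finally have G: "distr (archimedean_path t) borel snd = unif" .
  have "AE x in distr (archimedean_path t) borel fst. x \<in> {-1..1}" "AE x in distr (archimedean_path t) borel snd. x \<in> {-1..1}"
    using AE_unif by (simp_all only: F G)
  then have "AE p in archimedean_path t. p \<in> {-1..1} \<times> {-1..1}"
    by (auto simp: AE_distr_iff elim: eventually_elim2)
  then have "emeasure (archimedean_path t) ({-1..1} \<times> {-1..1}) = 1"
    by (intro P.emeasure_eq_1_AE) (auto simp: S borel_Times)
  then show ?thesis using P S F G by (simp add: permutons_def)
qed

lemma archimedean_path_0: "archimedean_path 0 = id_permuton"
  and archimedean_path_1: "archimedean_path 1 = rev_permuton"
proof -
  let ?A = archimedean_measure
  have f: "distr ?A borel fst = unif" "distr ?A borel snd = unif"
    using archimedean_projection[of 0] archimedean_projection[of "pi / 2"] by simp_all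
  have m: "(\<lambda>u. (u, u)) \<in> borel \<rightarrow>\<^sub>M (borel :: (real \<times> real) measure)"
     "(\<lambda>u. (- u, u)) \<in> borel \<rightarrow>\<^sub>M (borel :: (real \<times> real) measure)"
     "(\<lambda>u. (u, - u)) \<in> borel \<rightarrow>\<^sub>M (borel :: (real \<times> real) measure)"
    by (auto intro!: borel_measurable_continuous_onI continuous_intros)
  have "id_permuton = distr (distr ?A borel fst) borel (\<lambda>u. (u, u))"
    by (simp add: id_permuton_def f)
  also have "\<dots> = distr ?A borel ((\<lambda>u. (u, u)) \<circ> fst)"
    using m by (intro distr_distr) auto
  also have "(\<lambda>u. (u, u)) \<circ> fst = rotating_pair 0"
    by (auto simp: rotating_pair_def)
  finally show "archimedean_path 0 = id_permuton" by (simp add: archimedean_path_eq)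
  \<comment> \<open>The parameter is reflected because \<open>rotating_pair 1\<close> has the form
    \<open>(- y, y)\<close>.\<close>
  have "rev_permuton = distr (distr unif borel uminus) borel (\<lambda>u. (u, - u))"
    by (simp add: rev_permuton_def distr_uminus_unif)
  also have "\<dots> = distr unif borel ((\<lambda>u. (u, - u)) \<circ> uminus)"
    using m by (intro distr_distr) auto
  also have "\<dots> = distr (distr ?A borel snd) borel (\<lambda>u. (- u, u))"
    by (simp add: f comp_def)
  also have "\<dots> = distr ?A borel ((\<lambda>u. (- u, u)) \<circ> snd)"
    using m by (intro distr_distr) auto
  also have "(\<lambda>u. (- u, u)) \<circ> snd = rotating_pair 1"
    by (auto simp: rotating_pair_def)
  finally show "archimedean_path 1 = rev_permuton" by (simp add: archimedean_path_eq)
qed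

lemma angle_id_permuton: "angle id_permuton = 0"
proof -
  have "integral\<^sup>L id_permuton (\<lambda>p. (diag p)\<^sup>2) = integral\<^sup>L unif (\<lambda>u. (diag (u, u))\<^sup>2)"
    unfolding id_permuton_def
    by (rule integral_distr) (auto intro!: borel_measurable_continuous_onI continuous_intros)
  then have "integral\<^sup>L id_permuton (\<lambda>p. (diag p)\<^sup>2) = 1 / 3"
    by (simp add: diag_def unif_second_moment)
  then have "3 * integral\<^sup>L id_permuton (\<lambda>p. (diag p)\<^sup>2) = 1" by simp
  then show ?thesis unfolding angle_def by (simp only: real_sqrt_one arccos_1)
qed

lemma angle_rev_permuton: "angle rev_permuton = pi / 2"
proof -
  have "integral\<^sup>L rev_permuton (\<lambda>p. (diag p)\<^sup>2) = integral\<^sup>L unif (\<lambda>u. (diag (u, - u))\<^sup>2)"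
    unfolding rev_permuton_def
    by (rule integral_distr) (auto intro!: borel_measurable_continuous_onI continuous_intros)
  then have "integral\<^sup>L rev_permuton (\<lambda>p. (diag p)\<^sup>2) = 0"
    by (simp add: diag_def)
  then show ?thesis by (simp add: angle_def)
qed

text \<open>Moving the same point by \<open>rotating_pair\<close> at both times couples the laws.
  The cost is 2/3 of the squared chord between the half-speed angles, and a chord is at most its
  arc: \<open>2/3 * (pi/2)\<^sup>2 = pi\<^sup>2 / 6\<close>.\<close>

lemma wasserstein_archimedean_path:
  "(wasserstein (archimedean_path s) (archimedean_path t))\<^sup>2 \<le> pi\<^sup>2 / 6 * (s - t)\<^sup>2"
proof -
  let ?A = archimedean_measure and ?a = "pi / 2 * s" and ?b = "pi / 2 * t"
  interpret A: prob_space ?A by (rule prob_space_archimedean)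
  define T where "T p = (rotating_pair s p, rotating_pair t p)" for p
  have T [measurable]: "T \<in> borel \<rightarrow>\<^sub>M borel"
    unfolding T_def[abs_def] rotating_pair_def by (intro borel_measurable_continuous_onI continuous_intros)
  define \<gamma> where "\<gamma> = distr ?A borel T"
  have "distr \<gamma> borel fst = archimedean_path s" "distr \<gamma> borel snd = archimedean_path t"
    unfolding \<gamma>_def archimedean_path_eq
    by (subst distr_distr; auto intro!: distr_cong simp: T_def)+
  then have \<gamma>: "\<gamma> \<in> couplings (archimedean_path s) (archimedean_path t)"
    by (auto simp: couplings_def \<gamma>_def intro!: A.prob_space_distr)
  have sq: "integral\<^sup>L ?A (\<lambda>p. (fst p)\<^sup>2) = 1 / 3" "integral\<^sup>L ?A (\<lambda>p. (snd p)\<^sup>2) = 1 / 3"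
    "integrable ?A (\<lambda>p. (fst p)\<^sup>2)" "integrable ?A (\<lambda>p. (snd p)\<^sup>2)"
  proof -
    have f: "distr ?A borel fst = unif" "distr ?A borel snd = unif"
      using archimedean_projection[of 0] archimedean_projection[of "pi / 2"] by simp_all
    have "integral\<^sup>L (distr ?A borel fst) (\<lambda>x. x\<^sup>2) = integral\<^sup>L ?A (\<lambda>p. (fst p)\<^sup>2)"
      "integral\<^sup>L (distr ?A borel snd) (\<lambda>x. x\<^sup>2) = integral\<^sup>L ?A (\<lambda>p. (snd p)\<^sup>2)"
      by (auto intro!: integral_distr)
    moreover have i: "integrable (distr ?A borel fst) (\<lambda>x. x\<^sup>2)" "integrable (distr ?A borel snd) (\<lambda>x. x\<^sup>2)"
      unfolding f by (auto intro!: integrable_unif continuous_intros)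
    have "integrable ?A (\<lambda>p. (fst p)\<^sup>2)" "integrable ?A (\<lambda>p. (snd p)\<^sup>2)"
      by (rule integrable_distr[OF _ i(1)] integrable_distr[OF _ i(2)], simp)+
    ultimately show "integral\<^sup>L ?A (\<lambda>p. (fst p)\<^sup>2) = 1 / 3" "integral\<^sup>L ?A (\<lambda>p. (snd p)\<^sup>2) = 1 / 3"
      "integrable ?A (\<lambda>p. (fst p)\<^sup>2)" "integrable ?A (\<lambda>p. (snd p)\<^sup>2)"
      by (simp_all add: f unif_second_moment)
  qed
  have chord: "(cos ?a - cos ?b)\<^sup>2 + (sin ?a - sin ?b)\<^sup>2 \<le> (?a - ?b)\<^sup>2"
  proof -
    have "(cos ?a - cos ?b)\<^sup>2 + (sin ?a - sin ?b)\<^sup>2 = (norm (cis ?a - cis ?b))\<^sup>2"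
      by (simp add: cmod_power2)
    also have "\<dots> \<le> \<bar>?a - ?b\<bar>\<^sup>2"
      using iexp_Lipschitz[of ?a ?b] unfolding cis_conv_exp by (rule power_mono) simp
    finally show ?thesis by (simp only: power2_abs)
  qed
  have "transport_cost \<gamma> = integral\<^sup>L ?A (\<lambda>p. (norm (rotating_pair s p - rotating_pair t p))\<^sup>2)"
    unfolding transport_cost_def \<gamma>_def
    by (subst integral_distr) (auto simp: T_def case_prod_beta')
  also have "\<dots> = integral\<^sup>L ?A (\<lambda>p. 2 * ((cos ?a - cos ?b)\<^sup>2 * (fst p)\<^sup>2 + (sin ?a - sin ?b)\<^sup>2 * (snd p)\<^sup>2))"
    unfolding norm_sq_diag_anti diag_anti_rotating_pair
    by (simp flip: left_diff_distrib power_mult_distrib)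
  also have "\<dots> = 2 * ((cos ?a - cos ?b)\<^sup>2 * integral\<^sup>L ?A (\<lambda>p. (fst p)\<^sup>2) + (sin ?a - sin ?b)\<^sup>2 * integral\<^sup>L ?A (\<lambda>p. (snd p)\<^sup>2))"
    using sq(3,4) by simp
  also have "\<dots> = 2 / 3 * ((cos ?a - cos ?b)\<^sup>2 + (sin ?a - sin ?b)\<^sup>2)"
    unfolding sq(1,2) by simp
  also have "\<dots> \<le> 2 / 3 * (?a - ?b)\<^sup>2"
    using chord by (intro mult_left_mono) auto
  also have "?a - ?b = pi / 2 * (s - t)" by (simp add: algebra_simps)
  finally have "transport_cost \<gamma> \<le> pi\<^sup>2 / 6 * (s - t)\<^sup>2"
    by (simp add: power_mult_distrib power_divide)
  with wasserstein_le_transport_cost[OF archimedean_path_permuton archimedean_path_permuton \<gamma>]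
  show ?thesis by linarith
qed

lemma energy_archimedean_path_le: "energy archimedean_path \<le> ennreal (pi\<^sup>2 / 6)"
  unfolding energy_def
proof (rule SUP_least, clarify)
  fix k :: nat and t :: "nat \<Rightarrow> real" assume "(k, t) \<in> partitions"
  then have t: "t 0 = 0" "t k = 1" "strict_mono_on {0..k} t" by (auto simp: partitions_def)
  have "(\<Sum>i=1..k. (wasserstein (archimedean_path (t i)) (archimedean_path (t (i - 1))))\<^sup>2 / (t i - t (i - 1)))
     \<le> (\<Sum>i=1..k. pi\<^sup>2 / 6 * (t i - t (i - 1)))"
  proof (rule sum_mono)
    fix i assume "i \<in> {1..k}"
    then have "t (i - 1) < t i" using t(3) by (auto simp: strict_mono_on_def)
    then show "(wasserstein (archimedean_path (t i)) (archimedean_path (t (i - 1))))\<^sup>2 / (t i - t (i - 1))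
       \<le> pi\<^sup>2 / 6 * (t i - t (i - 1))"
      using wasserstein_archimedean_path[of "t i" "t (i - 1)"]
      by (simp add: pos_divide_le_eq power2_eq_square mult.assoc)
  qed
  also have "\<dots> = pi\<^sup>2 / 6"
    unfolding sum_distrib_left[symmetric] using sum_telescope''[of 0 k t] t by simp
  finally show "ennreal (\<Sum>i=1..k. (wasserstein (archimedean_path (t i)) (archimedean_path (t (i - 1))))\<^sup>2 / (t i - t (i - 1)))
     \<le> ennreal (pi\<^sup>2 / 6)"
    by (rule ennreal_leI)
qed

lemma energy_id_rev_ge:
  assumes "\<forall>t\<in>{0..1}. \<mu> t \<in> permutons" "\<mu> 0 = id_permuton" "\<mu> 1 = rev_permuton"
  shows "ennreal (pi\<^sup>2 / 6) \<le> energy \<mu>"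
  using energy_ge_angle[OF assms(1)] assms(2,3)
  by (simp add: angle_id_permuton angle_rev_permuton power_divide)

section \<open>Rigidity of energy minimisers\<close>

lemma (in prob_space) expectation_abs_le_sqrt:
  fixes X :: "'a \<Rightarrow> real"
  assumes X: "X \<in> borel_measurable M" and X2: "integrable M (\<lambda>x. (X x)\<^sup>2)"
  shows "integrable M X" "expectation (\<lambda>x. \<bar>X x\<bar>) \<le> sqrt (expectation (\<lambda>x. (X x)\<^sup>2))"
proof -
  show I: "integrable M X" using X X2 by (rule square_integrable_imp_integrable)
  show "expectation (\<lambda>x. \<bar>X x\<bar>) \<le> sqrt (expectation (\<lambda>x. (X x)\<^sup>2))"
    using integral_Cauchy_Schwarz[of "\<lambda>x. \<bar>X x\<bar>" "\<lambda>_. 1"] I X2 prob_space by simp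
qed

text \<open>For \<open>\<theta> = pi / 2 * t\<close> with \<open>0 < t < 1\<close> this inverts
  \<open>rotating_pair t\<close>. Along the Archimedean path it recovers the underlying Archimedean
  point.\<close>

definition frame :: "real \<Rightarrow> real \<times> real \<Rightarrow> real \<times> real" where
  "frame \<theta> p = (diag p / cos \<theta>, anti p / sin \<theta>)"

lemma measurable_frame [measurable]: "frame \<theta> \<in> borel \<rightarrow>\<^sub>M borel"
  unfolding frame_def[abs_def] by (subst borel_prod[symmetric]) measurable

text \<open>The characteristic function of the law seen in its own frame. Its values are complex
  numbers, so constancy in time can be shown by a vanishing derivative.\<close>

definition frame_char :: "(real \<times> real) measure \<Rightarrow> real \<Rightarrow> real \<Rightarrow> complex" where
  "frame_char \<mu> a b = (\<integral>p. iexp (a * fst (frame (angle \<mu>) p) + b * snd (frame (angle \<mu>) p)) \<partial>\<mu>)"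

text \<open>The excess of the transport cost over the squared chord controls how far the coupling
  is from preserving the two rescaled coordinates.\<close>

lemma frame_char_diff_le:
  assumes \<mu>: "\<mu> \<in> permutons" and \<nu>: "\<nu> \<in> permutons" and \<gamma>: "\<gamma> \<in> couplings \<mu> \<nu>"
    and pos: "0 < cos (angle \<mu>)" "0 < cos (angle \<nu>)" "0 < sin (angle \<mu>)" "0 < sin (angle \<nu>)"
    and D: "transport_cost \<gamma> - 4 / 3 * (1 - cos (angle \<nu> - angle \<mu>)) \<le> D"
  shows "cmod (frame_char \<mu> a b - frame_char \<nu> a b)
    \<le> \<bar>a\<bar> * sqrt (D / (2 * (cos (angle \<mu>) * cos (angle \<nu>)))) + \<bar>b\<bar> * sqrt (D / (2 * (sin (angle \<mu>) * sin (angle \<nu>))))"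
proof -
  interpret prob_space \<gamma> by (rule coupling_prob_space[OF \<mu> \<nu> \<gamma>])
  note [measurable_cong] = coupling_sets[OF \<mu> \<nu> \<gamma>]
  note int = coupling_integrable[OF \<mu> \<nu> \<gamma>] and mom = coupling_second_moments[OF \<mu> \<nu> \<gamma>]
  define c c' s s' where "c = cos (angle \<mu>)" and "c' = cos (angle \<nu>)" and "s = sin (angle \<mu>)" and "s' = sin (angle \<nu>)"
  have p: "0 < c" "0 < c'" "0 < s" "0 < s'" using pos by (simp_all add: c_def c'_def s_def s'_def)
  define P Q where "P = expectation (\<lambda>z. diag (fst z) * diag (snd z))" and "Q = expectation (\<lambda>z. anti (fst z) * anti (snd z))"
  define X where "X z = diag (fst z) / c - diag (snd z) / c'" for z
  define Y where "Y z = anti (fst z) / s - anti (snd z) / s'" for z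
  have XY [measurable]: "X \<in> borel_measurable \<gamma>" "Y \<in> borel_measurable \<gamma>"
    unfolding X_def[abs_def] Y_def[abs_def] by measurable
  have X2: "(\<lambda>z. (X z)\<^sup>2) = (\<lambda>z. (diag (fst z))\<^sup>2 / c\<^sup>2 + (diag (snd z))\<^sup>2 / c'\<^sup>2 - 2 / (c * c') * (diag (fst z) * diag (snd z)))"
    and Y2: "(\<lambda>z. (Y z)\<^sup>2) = (\<lambda>z. (anti (fst z))\<^sup>2 / s\<^sup>2 + (anti (snd z))\<^sup>2 / s'\<^sup>2 - 2 / (s * s') * (anti (fst z) * anti (snd z)))"
    by (auto simp: X_def Y_def power2_diff power_divide)
  have iX: "integrable \<gamma> (\<lambda>z. (X z)\<^sup>2)" and iY: "integrable \<gamma> (\<lambda>z. (Y z)\<^sup>2)"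
    unfolding X2 Y2 using int by simp_all
  \<comment> \<open>The excess of the cost is four times the sum of the two Cauchy-Schwarz deficits.
    Both are nonnegative, so each is at most \<open>D / 4\<close>.\<close>
  have ineq: "P \<le> c * c' / 3" "Q \<le> s * s' / 3" "4 * ((c * c' / 3 - P) + (s * s' / 3 - Q)) \<le> D"
    using coupling_correlation_le[OF \<mu> \<nu> \<gamma>] D transport_cost_eq[OF \<mu> \<nu> \<gamma>]
    by (simp_all add: P_def Q_def c_def c'_def s_def s'_def cos_diff algebra_simps)
  \<comment> \<open>After rescaling, both \<open>diag\<close> terms have second moment 1/3, so the
    mean square difference is the Cauchy-Schwarz deficit up to the factor
    \<open>2 / (c * c')\<close>.\<close>
  have "expectation (\<lambda>z. (X z)\<^sup>2) = expectation (\<lambda>z. (diag (fst z))\<^sup>2) / c\<^sup>2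
      + expectation (\<lambda>z. (diag (snd z))\<^sup>2) / c'\<^sup>2 - 2 / (c * c') * P"
    unfolding X2 P_def using int by simp
  also have "\<dots> = 2 * (c * c' / 3 - P) / (c * c')"
    unfolding mom c_def[symmetric] c'_def[symmetric] using p by (simp add: field_simps)
  also have "\<dots> \<le> 2 * (D / 4) / (c * c')"
    using ineq p by (intro divide_right_mono mult_left_mono) auto
  also have "\<dots> = D / (2 * (c * c'))" by simp
  finally have EX: "expectation (\<lambda>z. \<bar>X z\<bar>) \<le> sqrt (D / (2 * (c * c')))"
    using expectation_abs_le_sqrt(2)[OF XY(1) iX] by (meson order_trans real_sqrt_le_mono)
  have "expectation (\<lambda>z. (Y z)\<^sup>2) = expectation (\<lambda>z. (anti (fst z))\<^sup>2) / s\<^sup>2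
      + expectation (\<lambda>z. (anti (snd z))\<^sup>2) / s'\<^sup>2 - 2 / (s * s') * Q"
    unfolding Y2 Q_def using int by simp
  also have "\<dots> = 2 * (s * s' / 3 - Q) / (s * s')"
    unfolding mom s_def[symmetric] s'_def[symmetric] using p by (simp add: field_simps)
  also have "\<dots> \<le> 2 * (D / 4) / (s * s')"
    using ineq p by (intro divide_right_mono mult_left_mono) auto
  also have "\<dots> = D / (2 * (s * s'))" by simp
  finally have EY: "expectation (\<lambda>z. \<bar>Y z\<bar>) \<le> sqrt (D / (2 * (s * s')))"
    using expectation_abs_le_sqrt(2)[OF XY(2) iY] by (meson order_trans real_sqrt_le_mono)
  define f where "f p = iexp (a * fst (frame (angle \<mu>) p) + b * snd (frame (angle \<mu>) p))" for p
  define g where "g p = iexp (a * fst (frame (angle \<nu>) p) + b * snd (frame (angle \<nu>) p))" for p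
  have [measurable]: "f \<in> borel_measurable borel" "g \<in> borel_measurable borel"
    unfolding f_def[abs_def] g_def[abs_def] by measurable
  have ifg: "integrable \<gamma> (\<lambda>z. f (fst z))" "integrable \<gamma> (\<lambda>z. g (snd z))"
    by (auto intro!: integrable_const_bound[where B=1] simp: f_def g_def simp del: of_real_add of_real_mult)
  have "frame_char \<mu> a b = integral\<^sup>L \<mu> f" "frame_char \<nu> a b = integral\<^sup>L \<nu> g"
    by (simp_all only: frame_char_def f_def[abs_def] g_def[abs_def])
  then have "frame_char \<mu> a b - frame_char \<nu> a b = expectation (\<lambda>z. f (fst z) - g (snd z))"
    using ifg coupling_integral[OF \<mu> \<nu> \<gamma>, of f] coupling_integral[OF \<mu> \<nu> \<gamma>, of g]
    by simp
  also have "cmod \<dots> \<le> expectation (\<lambda>z. cmod (f (fst z) - g (snd z)))"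
    by (rule integral_norm_bound)
  also have "\<dots> \<le> expectation (\<lambda>z. \<bar>a\<bar> * \<bar>X z\<bar> + \<bar>b\<bar> * \<bar>Y z\<bar>)"
  proof (rule integral_mono)
    show "integrable \<gamma> (\<lambda>z. cmod (f (fst z) - g (snd z)))" using ifg by auto
    show "integrable \<gamma> (\<lambda>z. \<bar>a\<bar> * \<bar>X z\<bar> + \<bar>b\<bar> * \<bar>Y z\<bar>)"
      using expectation_abs_le_sqrt(1)[OF XY(1) iX] expectation_abs_le_sqrt(1)[OF XY(2) iY] by auto
    fix z
    have "cmod (f (fst z) - g (snd z)) \<le> \<bar>a * X z + b * Y z\<bar>"
      unfolding f_def g_def
      by (rule iexp_Lipschitz[THEN order_trans])
         (simp add: frame_def X_def Y_def c_def c'_def s_def s'_def algebra_simps)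
    also have "\<dots> \<le> \<bar>a\<bar> * \<bar>X z\<bar> + \<bar>b\<bar> * \<bar>Y z\<bar>"
      by (simp add: abs_triangle_ineq flip: abs_mult)
    finally show "cmod (f (fst z) - g (snd z)) \<le> \<bar>a\<bar> * \<bar>X z\<bar> + \<bar>b\<bar> * \<bar>Y z\<bar>" .
  qed
  also have "\<dots> = \<bar>a\<bar> * expectation (\<lambda>z. \<bar>X z\<bar>) + \<bar>b\<bar> * expectation (\<lambda>z. \<bar>Y z\<bar>)"
    using expectation_abs_le_sqrt(1)[OF XY(1) iX] expectation_abs_le_sqrt(1)[OF XY(2) iY] by simp
  also have "\<dots> \<le> \<bar>a\<bar> * sqrt (D / (2 * (c * c'))) + \<bar>b\<bar> * sqrt (D / (2 * (s * s')))"
    using EX EY by (intro add_mono mult_left_mono) auto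
  finally show ?thesis by (simp only: c_def c'_def s_def s'_def)
qed

lemma one_minus_cos_ge: "x\<^sup>2 / 2 - x ^ 4 / 24 \<le> 1 - cos (x :: real)"
proof -
  have sum: "(\<Sum>k\<le>3. (\<i> * x)^k / fact k) = 1 + \<i> * x - x\<^sup>2 / 2 - \<i> * x ^ 3 / 6"
    by (simp add: numeral_eq_Suc power_mult_distrib field_simps)
  have "\<bar>Re (iexp x - (\<Sum>k\<le>3. (\<i> * x)^k / fact k))\<bar> \<le> \<bar>x\<bar>^(Suc 3) / fact (Suc 3)"
    using iexp_approx1[of x 3] abs_Re_le_cmod order_trans by blast
  also have "Re (iexp x - (\<Sum>k\<le>3. (\<i> * x)^k / fact k)) = cos x - (1 - x\<^sup>2 / 2)"
    unfolding sum by (simp add: Re_exp flip: of_real_power)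
  also have "\<bar>x\<bar>^(Suc 3) / fact (Suc 3) = x ^ 4 / 24"
    by (simp add: fact_numeral)
  finally show ?thesis by linarith
qed

text \<open>Quadratic increments force a zero derivative.\<close>

lemma constant_if_quadratic_increments:
  fixes f :: "real \<Rightarrow> 'a :: real_normed_vector"
  assumes "\<And>x y. u \<le> x \<Longrightarrow> x < y \<Longrightarrow> y \<le> v \<Longrightarrow> norm (f x - f y) \<le> K * (y - x)\<^sup>2" and "u \<le> v"
  shows "f u = f v"
proof -
  have le: "norm (f y - f x) \<le> K * (y - x)\<^sup>2" if "x \<in> {u..v}" "y \<in> {u..v}" for x y
    using assms(1)[of x y] assms(1)[of y x] that
    by (cases x y rule: linorder_cases) (auto simp: norm_minus_commute power2_commute)
  have "(f has_vector_derivative 0) (at x within {u..v})" if x: "x \<in> {u..v}" for x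
    unfolding has_vector_derivative_def has_derivative_within_alt
  proof (intro conjI allI impI)
    fix e :: real assume "0 < e"
    show "\<exists>d>0. \<forall>y\<in>{u..v}. norm (y - x) < d \<longrightarrow> norm (f y - f x - (y - x) *\<^sub>R 0) \<le> e * norm (y - x)"
    \<comment> \<open>The added 1 keeps the radius well defined for \<open>K = 0\<close>.\<close>
    proof (intro exI[of _ "e / (\<bar>K\<bar> + 1)"] conjI ballI impI)
      fix y assume y: "y \<in> {u..v}" "norm (y - x) < e / (\<bar>K\<bar> + 1)"
      then have "(\<bar>K\<bar> + 1) * \<bar>y - x\<bar> \<le> e" by (simp add: pos_less_divide_eq mult.commute)
      then have "(\<bar>K\<bar> + 1) * \<bar>y - x\<bar> * \<bar>y - x\<bar> \<le> e * \<bar>y - x\<bar>" by (rule mult_right_mono) simp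
      moreover have "K * (y - x)\<^sup>2 \<le> (\<bar>K\<bar> + 1) * (y - x)\<^sup>2"
        by (rule mult_right_mono) auto
      moreover have "(\<bar>K\<bar> + 1) * \<bar>y - x\<bar> * \<bar>y - x\<bar> = (\<bar>K\<bar> + 1) * (y - x)\<^sup>2"
        by (simp add: power2_eq_square mult.assoc)
      ultimately have "norm (f y - f x) \<le> e * \<bar>y - x\<bar>" using le[OF x y(1)] by linarith
      then show "norm (f y - f x - (y - x) *\<^sub>R 0) \<le> e * norm (y - x)" by simp
    qed (use \<open>0 < e\<close> in \<open>simp add: add_nonneg_pos\<close>)
  qed (simp add: bounded_linear_zero)
  then obtain c where "\<And>x. x \<in> {u..v} \<Longrightarrow> f x = c"
    using has_vector_derivative_zero_constant[of "{u..v}" f] by auto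
  then show ?thesis using \<open>u \<le> v\<close> by auto
qed

lemma quarter_turn_pos:
  assumes "0 < t" "t < 1"
  shows "0 < cos (pi / 2 * t)" "0 < sin (pi / 2 * t)"
proof -
  have "0 < pi / 2 * t" "pi / 2 * t < pi / 2" using assms by simp_all
  then show "0 < cos (pi / 2 * t)" "0 < sin (pi / 2 * t)"
    using pi_half_less_two by (auto intro!: cos_gt_zero sin_gt_zero)
qed

text \<open>For a minimiser the squared distance and twice the squared chord share the leading term
  \<open>pi\<^sup>2 / 6 * h\<^sup>2\<close>, so a nearly optimal coupling has excess of order
  \<open>h ^ 4\<close>. The square roots in \<open>frame_char_diff_le\<close> turn this into
  increments of order \<open>h\<^sup>2\<close>.\<close>

lemma energy_minimiser_frame_char:
  assumes permuton: "\<forall>t\<in>{0..1}. \<mu> t \<in> permutons"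
    and E: "energy \<mu> \<le> ennreal (pi\<^sup>2 / 6)"
    and \<theta>: "angle (\<mu> 0) = 0" "angle (\<mu> 1) = pi / 2"
    and st: "0 < s" "s \<le> t" "t < 1"
  shows "frame_char (\<mu> s) a b = frame_char (\<mu> t) a b"
proof (rule constant_if_quadratic_increments[where f="\<lambda>r. frame_char (\<mu> r) a b", OF _ \<open>s \<le> t\<close>])
  let ?w = "pi / 2" and ?C = "cos (pi / 2 * t)" and ?S = "sin (pi / 2 * s)"
  have ang: "angle (\<mu> r) = pi / 2 * r" if "0 < r" "r < 1" for r
    by (rule energy_minimiser_angle[OF permuton E \<theta>]) (use that in auto)
  fix x y assume xy: "s \<le> x" "x < y" "y \<le> t"
  then have xy01: "0 < x" "x < 1" "0 < y" "y < 1" using st by auto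
  then have px: "\<mu> x \<in> permutons" and py: "\<mu> y \<in> permutons" by (auto intro!: permuton[rule_format])
  note ax = ang[OF xy01(1,2)] and ay = ang[OF xy01(3,4)]
  define h where "h = y - x"
  have h: "0 < h" using xy by (simp add: h_def)
  have W: "(wasserstein (\<mu> y) (\<mu> x))\<^sup>2 \<le> pi\<^sup>2 / 6 * h\<^sup>2"
    unfolding h_def by (rule energy_minimiser_wasserstein[OF permuton E \<theta>]) (use xy xy01 in auto)
  \<comment> \<open>The slack of the coupling is chosen of the same order as the Taylor error of the
    chord.\<close>
  have "0 < h ^ 4" using h by simp
  from wasserstein_approx[OF py px this] obtain \<gamma> where \<gamma>: "\<gamma> \<in> couplings (\<mu> y) (\<mu> x)"
    and cost: "transport_cost \<gamma> < (wasserstein (\<mu> y) (\<mu> x))\<^sup>2 + h ^ 4"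
    by blast
  have "cos (angle (\<mu> x) - angle (\<mu> y)) = cos (?w * h)"
    unfolding ax ay h_def right_diff_distrib by (rule cos_diff[THEN trans]) (simp add: cos_diff mult.commute)
  then have cos_eq: "1 - cos (angle (\<mu> x) - angle (\<mu> y)) = 1 - cos (?w * h)" by (simp only:)
  have "transport_cost \<gamma> - 4 / 3 * (1 - cos (angle (\<mu> x) - angle (\<mu> y)))
      \<le> pi\<^sup>2 / 6 * h\<^sup>2 + h ^ 4 - 4 / 3 * ((?w * h)\<^sup>2 / 2 - (?w * h) ^ 4 / 24)"
  proof -
    have "c - 4 / 3 * d \<le> B + k - 4 / 3 * l" if "c < w + k" "w \<le> B" "l \<le> d" for c d B k l w :: real
      using that by linarith
    from this[OF cost W one_minus_cos_ge] show ?thesis unfolding cos_eq .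
  qed
  \<comment> \<open>The quadratic terms cancel, and \<open>4/3 * 1/24 = 1/18\<close>. Since
    \<open>?w < 2\<close>, the bracket is then at most \<open>1 + 16/18 < 2\<close>.\<close>
  also have "\<dots> = h ^ 4 * (1 + ?w ^ 4 / 18)"
    by (simp add: power_mult_distrib power_divide algebra_simps)
  also have "\<dots> \<le> h ^ 4 * 2"
  proof -
    have "?w ^ 4 \<le> 2 ^ 4" using pi_half_less_two by (intro power_mono) auto
    then show ?thesis using h by (intro mult_left_mono) auto
  qed
  finally have D: "transport_cost \<gamma> - 4 / 3 * (1 - cos (angle (\<mu> x) - angle (\<mu> y))) \<le> h ^ 4 * 2" .
  have C: "0 < ?C" and S: "0 < ?S" using quarter_turn_pos st by auto
  \<comment> \<open>\<open>?C\<close> and \<open>?S\<close> bound cosine and sine of the angle from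
    below on all of \<open>[s, t]\<close>, which makes the quadratic constant uniform there.\<close>
  have mono: "?C \<le> cos (angle (\<mu> r)) \<and> ?S \<le> sin (angle (\<mu> r))" if r: "s \<le> r" "r \<le> t" for r
  proof -
    have a: "angle (\<mu> r) = ?w * r" using r st by (intro ang) auto
    have le: "?w * s \<le> ?w * r" "?w * r \<le> ?w * t" "?w * t \<le> ?w * 1" "?w * 0 \<le> ?w * s"
      by (rule mult_left_mono; use r st in simp)+
    show ?thesis
      unfolding a using le pi_gt_zero by (intro conjI cos_monotone_0_pi_le sin_monotone_2pi_le) linarith+
  qed
  have cx: "?C \<le> cos (angle (\<mu> x))" and cy: "?C \<le> cos (angle (\<mu> y))"
    and sx: "?S \<le> sin (angle (\<mu> x))" and sy: "?S \<le> sin (angle (\<mu> y))"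
    using mono[of x] mono[of y] xy by auto
  have root: "sqrt (h ^ 4 * 2 / (2 * (p * q))) \<le> h\<^sup>2 / m" if "0 < m" "m \<le> p" "m \<le> q" for m p q
  proof -
    have "m * m \<le> p * q" using that by (intro mult_mono) auto
    moreover have "0 < m * m" using that by simp
    ultimately have "h ^ 4 / (p * q) \<le> h ^ 4 / (m * m)"
      using h by (intro divide_left_mono) (auto intro!: mult_pos_pos order_less_le_trans[OF that(1)] that)
    also have "\<dots> = (h\<^sup>2 / m)\<^sup>2" by (simp add: power_divide power2_eq_square power4_eq_xxxx mult.assoc)
    finally have "sqrt (h ^ 4 / (p * q)) \<le> sqrt ((h\<^sup>2 / m)\<^sup>2)" by (rule real_sqrt_le_mono)
    then show ?thesis using that by simp
  qed
  have pos: "0 < cos (angle (\<mu> y))" "0 < cos (angle (\<mu> x))" "0 < sin (angle (\<mu> y))" "0 < sin (angle (\<mu> x))"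
    using cx cy sx sy C S by linarith+
  note frame_char_diff_le[OF py px \<gamma> pos D, of a b]
  also have "\<bar>a\<bar> * sqrt (h ^ 4 * 2 / (2 * (cos (angle (\<mu> y)) * cos (angle (\<mu> x)))))
      + \<bar>b\<bar> * sqrt (h ^ 4 * 2 / (2 * (sin (angle (\<mu> y)) * sin (angle (\<mu> x)))))
      \<le> \<bar>a\<bar> * (h\<^sup>2 / ?C) + \<bar>b\<bar> * (h\<^sup>2 / ?S)"
    by (intro add_mono mult_left_mono root[OF C cy cx] root[OF S sy sx] abs_ge_zero)
  also have "\<dots> = (\<bar>a\<bar> / ?C + \<bar>b\<bar> / ?S) * (y - x)\<^sup>2"
    unfolding h_def[symmetric] distrib_right times_divide_eq_left times_divide_eq_right ..
  finally show "cmod (frame_char (\<mu> x) a b - frame_char (\<mu> y) a b) \<le> (\<bar>a\<bar> / ?C + \<bar>b\<bar> / ?S) * (y - x)\<^sup>2"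
    by (simp only: norm_minus_commute)
qed

text \<open>The hypotheses cover directions strictly inside two quadrants. Continuity of the
  characteristic function adds the axes, and the symmetry of \<open>unif\<close> under
  \<open>r\<close> to \<open>- r\<close> adds the opposite quadrants.\<close>

lemma uniform_projectionsI_off_axes:
  assumes N: "prob_space N" and sets: "sets N = sets borel"
    and plus: "\<And>t. 0 < t \<Longrightarrow> t < 1 \<Longrightarrow> distr N borel (\<lambda>p. cos (pi / 2 * t) * fst p + sin (pi / 2 * t) * snd p) = unif"
    and minus: "\<And>t. 0 < t \<Longrightarrow> t < 1 \<Longrightarrow> distr N borel (\<lambda>p. cos (pi / 2 * t) * fst p - sin (pi / 2 * t) * snd p) = unif"
  shows "uniform_projections N"
proof -
  interpret N: prob_space N by fact
  note [measurable_cong] = sets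
  define \<psi> where "\<psi> a b = (\<integral>p. iexp (a * fst p + b * snd p) \<partial>N)" for a b
  have char_lin: "char (distr N borel (\<lambda>p. a * fst p + b * snd p)) r = \<psi> (r * a) (r * b)" for a b r
    unfolding char_def \<psi>_def
    by (subst integral_distr) (auto simp: algebra_simps)
  have cont: "(\<lambda>n. \<psi> (a n) (b n)) \<longlonglongrightarrow> \<psi> a' b'" if "a \<longlonglongrightarrow> a'" "b \<longlonglongrightarrow> b'" for a b a' b'
    unfolding \<psi>_def
    by (rule integral_dominated_convergence[where w="\<lambda>_. 1"]) (auto intro!: tendsto_intros that)
  have plus': "\<psi> (r * cos (pi / 2 * t)) (r * sin (pi / 2 * t)) = char unif r" if "0 < t" "t < 1" for r t
    using char_lin[of "cos (pi / 2 * t)" "sin (pi / 2 * t)" r] plus[OF that] by simp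
  have minus': "\<psi> (r * cos (pi / 2 * t)) (r * (- sin (pi / 2 * t))) = char unif r" if "0 < t" "t < 1" for r t
    using char_lin[of "cos (pi / 2 * t)" "- sin (pi / 2 * t)" r] minus[OF that] by simp
  have closed: "\<psi> (r * cos (pi / 2 * t)) (r * (\<sigma> * sin (pi / 2 * t))) = char unif r"
    if t: "0 \<le> t" "t \<le> 1" and \<sigma>: "\<sigma> = 1 \<or> \<sigma> = - 1" for r t \<sigma>
  proof -
    \<comment> \<open>A convex combination of \<open>t\<close> and \<open>1 / 2\<close>; the shift
      by 2 keeps the weight of \<open>1 / 2\<close> strictly between 0 and 1, so \<open>q n\<close>
      is interior even when \<open>t\<close> is an endpoint.\<close>
    define q where "q n = t + (1 / 2 - t) / real (n + 2)" for n
    have "(\<lambda>n. (1 / 2 - t) / real (n + 2)) \<longlonglongrightarrow> 0" by real_asymp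
    then have "(\<lambda>n. t + (1 / 2 - t) / real (n + 2)) \<longlonglongrightarrow> t + 0" by (intro tendsto_intros)
    then have q: "q \<longlonglongrightarrow> t" by (simp add: q_def[abs_def])
    have q01: "0 < q n \<and> q n < 1" for n
    proof -
      define x where "x = 1 / real (n + 2)"
      have x: "0 < x" "x < 1" by (simp_all add: x_def)
      have "q n = t + (1 / 2 - t) * x" by (simp add: q_def x_def)
      then have q: "q n = t * (1 - x) + x / 2" by (simp add: algebra_simps)
      have "0 \<le> t * (1 - x)" "t * (1 - x) \<le> 1 * (1 - x)"
        using t x by (auto intro!: mult_nonneg_nonneg mult_right_mono)
      moreover have "0 < y + x / 2 \<and> y + x / 2 < 1" if "0 \<le> y" "y \<le> 1 * (1 - x)" for y
        using that x by auto
      ultimately show ?thesis unfolding q by blast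
    qed
    have "(\<lambda>n. \<psi> (r * cos (pi / 2 * q n)) (r * (\<sigma> * sin (pi / 2 * q n))))
        \<longlonglongrightarrow> \<psi> (r * cos (pi / 2 * t)) (r * (\<sigma> * sin (pi / 2 * t)))"
      by (intro cont tendsto_intros q)
    moreover have "\<psi> (r * cos (pi / 2 * q n)) (r * (\<sigma> * sin (pi / 2 * q n))) = char unif r" for n
      using \<sigma> plus'[of "q n" r] minus'[of "q n" r] q01[of n] by auto
    ultimately show ?thesis by (simp add: LIMSEQ_const_iff)
  qed
  have "distr N borel (\<lambda>p. p \<bullet> u) = unif" if u: "norm u = 1" for u
  proof (rule Levy_uniqueness[OF _ real_distribution_unif])
    show "real_distribution (distr N borel (\<lambda>p. p \<bullet> u))"
      by (intro real_distribution.intro N.prob_space_distr real_distribution_axioms.intro) auto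
    obtain a b where ab: "u = (a, b)" by (cases u)
    have "sqrt (a\<^sup>2 + b\<^sup>2) = 1" using u by (simp add: ab norm_Pair)
    then have sq: "a\<^sup>2 + b\<^sup>2 = 1" by simp
    define t where "t = arccos \<bar>a\<bar> / (pi / 2)"
    have "a\<^sup>2 \<le> 1" using sq zero_le_power2[of b] by linarith
    then have a1: "\<bar>a\<bar> \<le> 1" by (simp only: abs_square_le_1)
    have a0: "0 \<le> \<bar>a\<bar>" "- 1 \<le> \<bar>a\<bar>" using abs_ge_zero[of a] by linarith+
    note acos = arccos_lbound[OF a0(2) a1] arccos_le_pi2[OF a0(1) a1] cos_arccos[OF a0(2) a1] sin_arccos[OF a0(2) a1]
    have pt: "pi / 2 * t = arccos \<bar>a\<bar>" by (simp add: t_def)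
    have "1 - \<bar>a\<bar>\<^sup>2 = b\<^sup>2" using sq by simp
    then have cs: "cos (pi / 2 * t) = \<bar>a\<bar>" "sin (pi / 2 * t) = \<bar>b\<bar>"
      using acos(3,4) unfolding pt by simp_all
    have t: "0 \<le> t" "t \<le> 1" using acos(1,2) by (simp_all add: t_def)
    have cl: "\<psi> (r * \<bar>a\<bar>) (r * \<bar>b\<bar>) = char unif r" "\<psi> (r * \<bar>a\<bar>) (r * - \<bar>b\<bar>) = char unif r" for r
      using closed[OF t, of 1 r] closed[OF t, of "- 1" r] unfolding cs by simp_all
    show "char (distr N borel (\<lambda>p. p \<bullet> u)) = char unif"
    proof
      fix r
      have "char (distr N borel (\<lambda>p. p \<bullet> u)) r = \<psi> (r * a) (r * b)"
        using char_lin[of a b r] by (simp add: ab inner_prod_def mult.commute)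
      also have "\<dots> = char unif r"
      proof (cases "0 \<le> a")
        case True
        then show ?thesis
          using cl[of r] by (cases "0 \<le> b") auto
      next
        case False
        then show ?thesis
          using cl[of "- r"] by (cases "0 \<le> b") (auto simp: char_unif_uminus)
      qed
      finally show "char (distr N borel (\<lambda>p. p \<bullet> u)) r = char unif r" .
    qed
  qed
  then show ?thesis using N sets by (simp add: uniform_projections_def)
qed

lemma rotating_pair_frame:
  assumes "0 < t" "t < 1"
  shows "rotating_pair t (frame (pi / 2 * t) p) = p"
  using quarter_turn_pos[OF assms]
  by (cases p) (simp add: rotating_pair_def frame_def diag_def anti_def field_simps)

text \<open>The framed law is the same at all interior times; \<open>N\<close> is its value at time
  \<open>1 / 2\<close>. Undoing the frame recovers \<open>\<mu> r\<close> from \<open>N\<close>, so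
  it remains to identify \<open>N\<close>.\<close>

lemma energy_minimiser_unique:
  assumes permuton: "\<forall>t\<in>{0..1}. \<mu> t \<in> permutons"
    and \<mu>0: "\<mu> 0 = id_permuton" and \<mu>1: "\<mu> 1 = rev_permuton"
    and E: "energy \<mu> \<le> ennreal (pi\<^sup>2 / 6)"
    and t: "t \<in> {0..1}"
  shows "\<mu> t = archimedean_path t"
proof -
  have \<theta>: "angle (\<mu> 0) = 0" "angle (\<mu> 1) = pi / 2"
    by (simp_all add: \<mu>0 \<mu>1 angle_id_permuton angle_rev_permuton)
  have ang: "angle (\<mu> r) = pi / 2 * r" if "0 < r" "r < 1" for r
    by (rule energy_minimiser_angle[OF permuton E \<theta>]) (use that in auto)
  have half: "0 < (1 / 2 :: real)" "1 / 2 < (1 :: real)" by simp_all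
  define N where "N = distr (\<mu> (1 / 2)) borel (frame (pi / 2 * (1 / 2)))"
  have prob: "prob_space (distr (\<mu> r) borel (frame (pi / 2 * r)))" if "0 < r" "r < 1" for r
  proof -
    have "\<mu> r \<in> permutons" using that by (intro permuton[rule_format]) auto
    then have [measurable_cong]: "sets (\<mu> r) = sets borel" and "prob_space (\<mu> r)"
      by (rule permuton_sets, rule permuton_prob_space)
    from this(2) show ?thesis by (rule prob_space.prob_space_distr) measurable
  qed
  have const: "distr (\<mu> r) borel (frame (pi / 2 * r)) = N" if r: "0 < r" "r < 1" for r
    unfolding N_def
  proof (rule Levy_uniqueness_plane)
    fix a b
    have "frame_char (\<mu> r) a b = frame_char (\<mu> (1 / 2)) a b"
    proof (cases "r \<le> 1 / 2")
      case True
      then show ?thesis using r half by (intro energy_minimiser_frame_char[OF permuton E \<theta>])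
    next
      case False
      then have "1 / 2 \<le> r" by simp
      then show ?thesis using r half by (intro energy_minimiser_frame_char[OF permuton E \<theta>, symmetric])
    qed
    moreover have fc: "(\<integral>p. iexp (a * fst p + b * snd p) \<partial>distr (\<mu> r) borel (frame (pi / 2 * r))) = frame_char (\<mu> r) a b"
      if "0 < r" "r < 1" for r
    proof -
      have "\<mu> r \<in> permutons" using that by (intro permuton[rule_format]) auto
      then have [measurable_cong]: "sets (\<mu> r) = sets borel" by (rule permuton_sets)
      show ?thesis unfolding frame_char_def ang[OF that] by (rule integral_distr) auto
    qed
    ultimately show "(\<integral>p. iexp (a * fst p + b * snd p) \<partial>distr (\<mu> r) borel (frame (pi / 2 * r)))
       = (\<integral>p. iexp (a * fst p + b * snd p) \<partial>distr (\<mu> (1 / 2)) borel (frame (pi / 2 * (1 / 2))))"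
      by (simp only: fc[OF r] fc[OF half])
  qed (use prob[OF r] prob[OF half] in auto)
  have \<mu>_eq: "\<mu> r = distr N borel (rotating_pair r)" if r: "0 < r" "r < 1" for r
  proof -
    have "\<mu> r \<in> permutons" using r by (intro permuton[rule_format]) auto
    then have s [measurable_cong]: "sets (\<mu> r) = sets borel" by (rule permuton_sets)
    have "distr N borel (rotating_pair r) = distr (\<mu> r) borel (rotating_pair r \<circ> frame (pi / 2 * r))"
      unfolding const[OF r, symmetric] by (rule distr_distr) auto
    also have "rotating_pair r \<circ> frame (pi / 2 * r) = (\<lambda>p. p)"
      using rotating_pair_frame[OF r] by auto
    also have "distr (\<mu> r) borel (\<lambda>p. p) = \<mu> r" using s by (intro distr_id2) simp
    finally show ?thesis by simp
  qed
  have N_sets [measurable_cong]: "sets N = sets borel" by (simp add: N_def)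
  have "uniform_projections N"
  proof (rule uniform_projectionsI_off_axes)
    show "prob_space N" unfolding N_def by (rule prob) auto
    show "sets N = sets borel" by fact
    fix r :: real assume r: "0 < r" "r < 1"
    then have "\<mu> r \<in> permutons" by (intro permuton[rule_format]) auto
    \<comment> \<open>The two uniform marginals of \<open>\<mu> r\<close> are projections of
      \<open>N\<close> in the directions of angle \<open>- pi / 2 * r\<close> and
      \<open>pi / 2 * r\<close>. Varying \<open>r\<close> gives all directions off the axes.\<close>
    then have "distr (distr N borel (rotating_pair r)) borel snd = unif" "distr (distr N borel (rotating_pair r)) borel fst = unif"
      unfolding \<mu>_eq[OF r, symmetric] by (rule permuton_marginals)+
    moreover have "distr (distr N borel (rotating_pair r)) borel snd = distr N borel (snd \<circ> rotating_pair r)"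
      "distr (distr N borel (rotating_pair r)) borel fst = distr N borel (fst \<circ> rotating_pair r)"
      by (rule distr_distr; measurable)+
    ultimately show "distr N borel (\<lambda>p. cos (pi / 2 * r) * fst p + sin (pi / 2 * r) * snd p) = unif"
      "distr N borel (\<lambda>p. cos (pi / 2 * r) * fst p - sin (pi / 2 * r) * snd p) = unif"
      by (simp_all only: comp_def rotating_pair_def fst_conv snd_conv)
  qed
  then have "N = archimedean_measure"
    using uniform_projections_archimedean by (rule uniform_projections_unique)
  then have "\<mu> r = archimedean_path r" if "0 < r" "r < 1" for r
    using \<mu>_eq[OF that] by (simp add: archimedean_path_eq)
  \<comment> \<open>At the ends the frame degenerates, and there the claim comes from the prescribed
    values.\<close>
  moreover have "t = 0 \<or> t = 1 \<or> 0 < t \<and> t < 1" using t by auto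
  ultimately show ?thesis
    using \<mu>0 \<mu>1 archimedean_path_0 archimedean_path_1 by metis
qed

theorem theorem3:
  fixes \<mu> :: "real \<Rightarrow> (real \<times> real) measure"
  assumes "permuton_path \<mu>"
    and "\<mu> 0 = id_permuton"
    and "\<mu> 1 = rev_permuton"
  shows "energy \<mu> \<ge> energy archimedean_path
    \<and> energy archimedean_path = ennreal (pi\<^sup>2 / 6)
    \<and> (energy \<mu> = energy archimedean_path \<longrightarrow> (\<forall>t\<in>{0..1}. \<mu> t = archimedean_path t))"
proof -
  have permuton: "\<forall>t\<in>{0..1}. \<mu> t \<in> permutons"
    using assms(1) by (simp add: permuton_path_def)
  \<comment> \<open>The Archimedean path itself runs from \<open>id_permuton\<close> to
    \<open>rev_permuton\<close>, so the general lower bound applies to it and meets the upper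
    bound.\<close>
  have "energy archimedean_path = ennreal (pi\<^sup>2 / 6)"
    using energy_archimedean_path_le
      energy_id_rev_ge[of archimedean_path] archimedean_path_permuton archimedean_path_0 archimedean_path_1
    by (intro antisym) auto
  then show ?thesis
    using energy_id_rev_ge[OF permuton assms(2,3)] energy_minimiser_unique[OF permuton assms(2,3)] by simp
qed

end
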